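(* Let $(L,r)$ be a Dirac-Nijenhuis structure on a manifold $M$, and let $\phi_j=\frac1j\mathrm{trace}(r^j)$ for $j\geq1$. If $\phi_1=\mathrm{trace}(r)$ is admissible, then $\phi_i$ is admissible for every $i\geq2$ and $$\{\phi_i,\phi_j\}=0,\qquad \forall\, i,j\geq1.$$
   Context: $\mathbb{T}M=TM\oplus T^*M$ carries the pairing $\langle(X,\alpha),(Y,\beta)\rangle=\beta(X)+\alpha(Y)$ and the Courant-Dorfman bracket $[\![(X,\alpha),(Y,\beta)]\!]=([X,Y],\mathcal{L}_X\beta-i_Yd\alpha)$. A Dirac structure is a subbundle $L\subset\mathbb{T}M$ with $L=L^\perp$ whose sections are closed under the bracket. For $r\in\Omega^1(M,TM)$, viewed as $r:TM\to TM$ with dual $r^*$, set $D^r_X(Y)=[Y,r(X)]-r([Y,X])$, $D^{r,*}_X(\alpha)=\mathcal{L}_X(r^*\alpha)-\mathcal{L}_{r(X)}\alpha$, $\mathbb{D}^r_X(Y,\alpha)=(D^r_X(Y),D^{r,*}_X(\alpha))$. $L$ and $r$ are compatible if $(r,r^* )(L)\subseteq L$ and $\mathbb{D}^r_X(\Gamma(L))\subseteq\Gamma(L)$ for all $X\in\mathfrak{X}(M)$. $r$ is Nijenhuis if $[r(X),r(Y)]-r([r(X),Y]+[X,r(Y)]-r[X,Y])=0$ for all $X,Y$. $(L,r)$ is Dirac-Nijenhuis if $L$ is Dirac, $r$ is Nijenhuis and they are compatible. For a Dirac structure $L$, a function $f\in C^\infty(M)$ is admissible if there exists $X_f\in\mathfrak{X}(M)$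 with $(X_f,df)\in\Gamma(L)$. On admissible functions there is a well-defined Poisson bracket $\{f,g\}=dg(X_f)$ (independent of the choice of $X_f$). *)

theory Defs
  imports "HOL-Analysis.Analysis"
begin

section \<open>Smooth maps between open sets\<close>

text \<open>
  All model spaces are finite-dimensional, so that \<open>f\<close> is \<open>C\<^sup>k\<^sup>+\<^sup>1\<close> on an open set iff it is
  differentiable there and all its directional derivatives are \<open>C\<^sup>k\<close>.
\<close>

fun Ck_on :: "nat \<Rightarrow> 'e::real_normed_vector set \<Rightarrow> ('e \<Rightarrow> 'f::real_normed_vector) \<Rightarrow> bool" where
  "Ck_on 0 U f \<longleftrightarrow> continuous_on U f"
| "Ck_on (Suc k) U f \<longleftrightarrow>
     (\<forall>x\<in>U. f differentiable (at x)) \<and> (\<forall>v. Ck_on k U (\<lambda>x. frechet_derivative f (at x) v))"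

definition smooth_on :: "'e::real_normed_vector set \<Rightarrow> ('e \<Rightarrow> 'f::real_normed_vector) \<Rightarrow> bool" where
  "smooth_on U f \<longleftrightarrow> (\<forall>k. Ck_on k U f)"


section \<open>Smooth manifolds\<close>

text \<open>
  The manifold is the whole type \<open>'a\<close>. A chart is its domain together with its coordinate map
  (whose values outside the domain are irrelevant). The model space \<open>'e\<close> is a finite-dimensional
  inner product space; the class \<open>euclidean_space\<close> is not used because it excludes dimension 0.
\<close>

type_synonym ('a, 'e) chart = "'a set \<times> ('a \<Rightarrow> 'e)"

definition chart_inv :: "('a, 'e) chart \<Rightarrow> 'e \<Rightarrow> 'a" where
  "chart_inv c = inv_into (fst c) (snd c)"

abbreviation chart_image :: "('a, 'e) chart \<Rightarrow> 'e set" where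
  "chart_image c \<equiv> snd c ` fst c"

locale smooth_manifold =
  fixes A :: "('a::{t2_space, second_countable_topology}, 'e::real_inner) chart set"
  assumes finite_dimensional: "\<exists>B::'e set. finite B \<and> span B = UNIV"
    and covering: "(\<Union>c\<in>A. fst c) = UNIV"
    and chart: "c \<in> A \<Longrightarrow>
      open (fst c) \<and> open (chart_image c) \<and>
      homeomorphism (fst c) (chart_image c) (snd c) (chart_inv c)"
    and transition: "c \<in> A \<Longrightarrow> d \<in> A \<Longrightarrow>
      smooth_on (snd c ` (fst c \<inter> fst d)) (snd d \<circ> chart_inv c)"

definition smooth_fun ::
    "('a, 'e::real_normed_vector) chart set \<Rightarrow> ('a \<Rightarrow> real) \<Rightarrow> bool" where
  "smooth_fun A f \<longleftrightarrow> (\<forall>c\<in>A. smooth_on (chart_image c) (f \<circ> chart_inv c))"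


section \<open>Tangent and cotangent bundle\<close>

text \<open>
  A tangent vector at \<open>p\<close> is an equivalence class of pairs (chart around \<open>p\<close>, vector of components),
  two pairs being equivalent if the derivative of the transition map relates their components.
  Each class has a unique representative for the chart \<open>chart_at A p\<close>, chosen once and for all.
  So \<open>T\<^sub>pM\<close> is identified with \<open>'e\<close> and \<open>T\<^sub>p\<^sup>*M\<close> with its dual, by means of \<open>chart_at A p\<close>. This
  identification need not depend continuously on \<open>p\<close>; smoothness of sections is always tested on
  their components in the charts of the atlas. Derivatives at \<open>p\<close> of fields are computed in
  \<open>chart_at A p\<close>, in which the components of a tangent vector at \<open>p\<close> are the vector itself.
\<close>

definition chart_at :: "('a, 'e) chart set \<Rightarrow> 'a \<Rightarrow> ('a, 'e) chart" where
  "chart_at A p = (SOME c. c \<in> A \<and> p \<in> fst c)"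

definition coords_at :: "('a, 'e) chart set \<Rightarrow> 'a \<Rightarrow> 'e" where
  "coords_at A p = snd (chart_at A p) p"

text \<open>\<open>to_coord A c p\<close> maps a tangent vector at \<open>p\<close> to its components in the chart \<open>c\<close>,
  and \<open>of_coord A c p\<close> is the inverse map.\<close>

definition to_coord ::
    "('a, 'e::real_normed_vector) chart set \<Rightarrow> ('a, 'e) chart \<Rightarrow> 'a \<Rightarrow> 'e \<Rightarrow> 'e" where
  "to_coord A c p = frechet_derivative (snd c \<circ> chart_inv (chart_at A p)) (at (coords_at A p))"

definition of_coord ::
    "('a, 'e::real_normed_vector) chart set \<Rightarrow> ('a, 'e) chart \<Rightarrow> 'a \<Rightarrow> 'e \<Rightarrow> 'e" where
  "of_coord A c p = frechet_derivative (snd (chart_at A p) \<circ> chart_inv c) (at (snd c p))"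

text \<open>Sections of \<open>TM\<close>, \<open>T\<^sup>*M\<close> and \<open>End(TM) = T\<^sup>*M \<otimes> TM\<close>. In finite dimension \<open>\<Rightarrow>\<^sub>L\<close> comprises all
  linear maps.\<close>

type_synonym ('a, 'e) vector_field = "'a \<Rightarrow> 'e"
type_synonym ('a, 'e) one_form = "'a \<Rightarrow> ('e \<Rightarrow>\<^sub>L real)"
type_synonym ('a, 'e) endo_field = "'a \<Rightarrow> ('e \<Rightarrow>\<^sub>L 'e)"

definition vf_rep :: "('a, 'e::real_normed_vector) chart set \<Rightarrow> ('a, 'e) chart \<Rightarrow>
    ('a, 'e) vector_field \<Rightarrow> 'e \<Rightarrow> 'e" where
  "vf_rep A c X x = (let p = chart_inv c x in to_coord A c p (X p))"

definition form_rep :: "('a, 'e::real_normed_vector) chart set \<Rightarrow> ('a, 'e) chart \<Rightarrow>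
    ('a, 'e) one_form \<Rightarrow> 'e \<Rightarrow> 'e \<Rightarrow> real" where
  "form_rep A c \<alpha> x v = (let p = chart_inv c x in blinfun_apply (\<alpha> p) (of_coord A c p v))"

definition endo_rep :: "('a, 'e::real_normed_vector) chart set \<Rightarrow> ('a, 'e) chart \<Rightarrow>
    ('a, 'e) endo_field \<Rightarrow> 'e \<Rightarrow> 'e \<Rightarrow> 'e" where
  "endo_rep A c r x v =
     (let p = chart_inv c x in to_coord A c p (blinfun_apply (r p) (of_coord A c p v)))"

definition smooth_vf ::
    "('a, 'e::real_normed_vector) chart set \<Rightarrow> ('a, 'e) vector_field \<Rightarrow> bool" where
  "smooth_vf A X \<longleftrightarrow> (\<forall>c\<in>A. smooth_on (chart_image c) (vf_rep A c X))"

definition smooth_form ::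
    "('a, 'e::real_normed_vector) chart set \<Rightarrow> ('a, 'e) one_form \<Rightarrow> bool" where
  "smooth_form A \<alpha> \<longleftrightarrow> (\<forall>c\<in>A. \<forall>v. smooth_on (chart_image c) (\<lambda>x. form_rep A c \<alpha> x v))"

definition smooth_endo ::
    "('a, 'e::real_normed_vector) chart set \<Rightarrow> ('a, 'e) endo_field \<Rightarrow> bool" where
  "smooth_endo A r \<longleftrightarrow> (\<forall>c\<in>A. \<forall>v. smooth_on (chart_image c) (\<lambda>x. endo_rep A c r x v))"

definition app_endo ::
    "('a, 'e::real_normed_vector) endo_field \<Rightarrow> ('a, 'e) vector_field \<Rightarrow> ('a, 'e) vector_field" where
  "app_endo r X = (\<lambda>p. blinfun_apply (r p) (X p))"

definition dual_endo ::
    "('a, 'e::real_normed_vector) endo_field \<Rightarrow> ('a, 'e) one_form \<Rightarrow> ('a, 'e) one_form" where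
  "dual_endo r \<alpha> = (\<lambda>p. \<alpha> p o\<^sub>L r p)"


section \<open>Cartan calculus\<close>

definition differential ::
    "('a, 'e::real_normed_vector) chart set \<Rightarrow> ('a \<Rightarrow> real) \<Rightarrow> ('a, 'e) one_form" where
  "differential A f p =
     Blinfun (frechet_derivative (f \<circ> chart_inv (chart_at A p)) (at (coords_at A p)))"

text \<open>\<open>[X,Y]\<^sup>j = X\<^sup>i \<partial>\<^sub>i Y\<^sup>j - Y\<^sup>i \<partial>\<^sub>i X\<^sup>j\<close>\<close>

definition lie_bracket :: "('a, 'e::real_normed_vector) chart set \<Rightarrow>
    ('a, 'e) vector_field \<Rightarrow> ('a, 'e) vector_field \<Rightarrow> ('a, 'e) vector_field" where
  "lie_bracket A X Y p =
     (let c = chart_at A p; x = coords_at A p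
      in frechet_derivative (vf_rep A c Y) (at x) (X p)
       - frechet_derivative (vf_rep A c X) (at x) (Y p))"

text \<open>\<open>(\<L>\<^sub>X \<alpha>)\<^sub>j = X\<^sup>i \<partial>\<^sub>i \<alpha>\<^sub>j + \<alpha>\<^sub>i \<partial>\<^sub>j X\<^sup>i\<close>; equivalently \<open>(\<L>\<^sub>X \<alpha>)(Z) = X(\<alpha>(Z)) - \<alpha>([X,Z])\<close>.\<close>

definition lie_deriv_form :: "('a, 'e::real_normed_vector) chart set \<Rightarrow>
    ('a, 'e) vector_field \<Rightarrow> ('a, 'e) one_form \<Rightarrow> ('a, 'e) one_form" where
  "lie_deriv_form A X \<alpha> p =
     (let c = chart_at A p; x = coords_at A p
      in Blinfun (\<lambda>v. frechet_derivative (\<lambda>y. form_rep A c \<alpha> y v) (at x) (X p)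
                    + blinfun_apply (\<alpha> p) (frechet_derivative (vf_rep A c X) (at x) v)))"

text \<open>\<open>(d\<alpha>)(u,v) = u\<^sup>i v\<^sup>j (\<partial>\<^sub>i \<alpha>\<^sub>j - \<partial>\<^sub>j \<alpha>\<^sub>i)\<close>, that is,
  \<open>d\<alpha>(Y,Z) = Y(\<alpha>(Z)) - Z(\<alpha>(Y)) - \<alpha>([Y,Z])\<close>.\<close>

definition ext_deriv :: "('a, 'e::real_normed_vector) chart set \<Rightarrow>
    ('a, 'e) one_form \<Rightarrow> 'a \<Rightarrow> 'e \<Rightarrow> 'e \<Rightarrow> real" where
  "ext_deriv A \<alpha> p u v =
     (let c = chart_at A p; x = coords_at A p
      in frechet_derivative (\<lambda>y. form_rep A c \<alpha> y v) (at x) u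
       - frechet_derivative (\<lambda>y. form_rep A c \<alpha> y u) (at x) v)"

definition interior_ext_deriv :: "('a, 'e::real_normed_vector) chart set \<Rightarrow>
    ('a, 'e) vector_field \<Rightarrow> ('a, 'e) one_form \<Rightarrow> ('a, 'e) one_form" where
  "interior_ext_deriv A Y \<alpha> p = Blinfun (ext_deriv A \<alpha> p (Y p))"


section \<open>Dirac structures\<close>

type_synonym 'e gen_vector = "'e \<times> ('e \<Rightarrow>\<^sub>L real)"
type_synonym ('a, 'e) gen_field = "'a \<Rightarrow> 'e gen_vector"

definition pairing :: "'e::real_normed_vector gen_vector \<Rightarrow> 'e gen_vector \<Rightarrow> real" where
  "pairing a b = blinfun_apply (snd b) (fst a) + blinfun_apply (snd a) (fst b)"

definition orth_compl :: "'e::real_normed_vector gen_vector set \<Rightarrow> 'e gen_vector set" where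
  "orth_compl V = {a. \<forall>b\<in>V. pairing a b = 0}"

definition smooth_gen :: "('a, 'e::real_normed_vector) chart set \<Rightarrow> ('a, 'e) gen_field \<Rightarrow> bool" where
  "smooth_gen A \<sigma> \<longleftrightarrow> smooth_vf A (fst \<circ> \<sigma>) \<and> smooth_form A (snd \<circ> \<sigma>)"

definition courant_bracket :: "('a, 'e::real_normed_vector) chart set \<Rightarrow>
    ('a, 'e) gen_field \<Rightarrow> ('a, 'e) gen_field \<Rightarrow> ('a, 'e) gen_field" where
  "courant_bracket A \<sigma> \<tau> =
     (\<lambda>p. (lie_bracket A (fst \<circ> \<sigma>) (fst \<circ> \<tau>) p,
           lie_deriv_form A (fst \<circ> \<sigma>) (snd \<circ> \<tau>) p
         - interior_ext_deriv A (fst \<circ> \<tau>) (snd \<circ> \<sigma>) p))"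

definition sections :: "('a, 'e::real_normed_vector) chart set \<Rightarrow>
    ('a \<Rightarrow> 'e gen_vector set) \<Rightarrow> ('a, 'e) gen_field set" where
  "sections A L = {\<sigma>. smooth_gen A \<sigma> \<and> (\<forall>p. \<sigma> p \<in> L p)}"

text \<open>Smooth local frames exist around each point. Multiplying by a bump function and shrinking
  the neighbourhood, one may take the frame to consist of restrictions of global smooth sections of
  \<open>TM \<oplus> T\<^sup>*M\<close>.\<close>

definition subbundle :: "('a::topological_space, 'e::real_normed_vector) chart set \<Rightarrow>
    ('a \<Rightarrow> 'e gen_vector set) \<Rightarrow> bool" where
  "subbundle A L \<longleftrightarrow>
     (\<forall>p. subspace (L p)) \<and>
     (\<forall>p. \<exists>U (k::nat) s. open U \<and> p \<in> U \<and> (\<forall>i<k. smooth_gen A (s i)) \<and>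
        (\<forall>q\<in>U. inj_on (\<lambda>i. s i q) {..<k} \<and> independent ((\<lambda>i. s i q) ` {..<k}) \<and>
               span ((\<lambda>i. s i q) ` {..<k}) = L q))"

definition dirac_structure :: "('a::topological_space, 'e::real_normed_vector) chart set \<Rightarrow>
    ('a \<Rightarrow> 'e gen_vector set) \<Rightarrow> bool" where
  "dirac_structure A L \<longleftrightarrow>
     subbundle A L \<and> (\<forall>p. L p = orth_compl (L p)) \<and>
     (\<forall>\<sigma>\<in>sections A L. \<forall>\<tau>\<in>sections A L. courant_bracket A \<sigma> \<tau> \<in> sections A L)"


section \<open>Dirac-Nijenhuis structures\<close>

definition D_vf :: "('a, 'e::real_normed_vector) chart set \<Rightarrow> ('a, 'e) endo_field \<Rightarrow>
    ('a, 'e) vector_field \<Rightarrow> ('a, 'e) vector_field \<Rightarrow> ('a, 'e) vector_field" where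
  "D_vf A r X Y =
     (\<lambda>p. lie_bracket A Y (app_endo r X) p - app_endo r (lie_bracket A Y X) p)"

definition D_form :: "('a, 'e::real_normed_vector) chart set \<Rightarrow> ('a, 'e) endo_field \<Rightarrow>
    ('a, 'e) vector_field \<Rightarrow> ('a, 'e) one_form \<Rightarrow> ('a, 'e) one_form" where
  "D_form A r X \<alpha> =
     (\<lambda>p. lie_deriv_form A X (dual_endo r \<alpha>) p - lie_deriv_form A (app_endo r X) \<alpha> p)"

definition D_gen :: "('a, 'e::real_normed_vector) chart set \<Rightarrow> ('a, 'e) endo_field \<Rightarrow>
    ('a, 'e) vector_field \<Rightarrow> ('a, 'e) gen_field \<Rightarrow> ('a, 'e) gen_field" where
  "D_gen A r X \<sigma> = (\<lambda>p. (D_vf A r X (fst \<circ> \<sigma>) p, D_form A r X (snd \<circ> \<sigma>) p))"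

definition compatible :: "('a, 'e::real_normed_vector) chart set \<Rightarrow>
    ('a \<Rightarrow> 'e gen_vector set) \<Rightarrow> ('a, 'e) endo_field \<Rightarrow> bool" where
  "compatible A L r \<longleftrightarrow>
     (\<forall>p. \<forall>(v, \<alpha>)\<in>L p. (blinfun_apply (r p) v, \<alpha> o\<^sub>L r p) \<in> L p) \<and>
     (\<forall>X. smooth_vf A X \<longrightarrow> (\<forall>\<sigma>\<in>sections A L. D_gen A r X \<sigma> \<in> sections A L))"

definition nijenhuis ::
    "('a, 'e::real_normed_vector) chart set \<Rightarrow> ('a, 'e) endo_field \<Rightarrow> bool" where
  "nijenhuis A r \<longleftrightarrow>
     (\<forall>X Y. smooth_vf A X \<longrightarrow> smooth_vf A Y \<longrightarrow>
        (\<forall>p. lie_bracket A (app_endo r X) (app_endo r Y) p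
           - blinfun_apply (r p)
               (lie_bracket A (app_endo r X) Y p + lie_bracket A X (app_endo r Y) p
              - blinfun_apply (r p) (lie_bracket A X Y p)) = 0))"

definition dirac_nijenhuis :: "('a::topological_space, 'e::real_normed_vector) chart set \<Rightarrow>
    ('a \<Rightarrow> 'e gen_vector set) \<Rightarrow> ('a, 'e) endo_field \<Rightarrow> bool" where
  "dirac_nijenhuis A L r \<longleftrightarrow>
     dirac_structure A L \<and> smooth_endo A r \<and> nijenhuis A r \<and> compatible A L r"


section \<open>Admissible functions and their Poisson bracket\<close>

definition hamiltonian_vf :: "('a, 'e::real_normed_vector) chart set \<Rightarrow>
    ('a \<Rightarrow> 'e gen_vector set) \<Rightarrow> ('a \<Rightarrow> real) \<Rightarrow> ('a, 'e) vector_field \<Rightarrow> bool" where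
  "hamiltonian_vf A L f X \<longleftrightarrow> smooth_vf A X \<and> (\<lambda>p. (X p, differential A f p)) \<in> sections A L"

definition admissible :: "('a, 'e::real_normed_vector) chart set \<Rightarrow>
    ('a \<Rightarrow> 'e gen_vector set) \<Rightarrow> ('a \<Rightarrow> real) \<Rightarrow> bool" where
  "admissible A L f \<longleftrightarrow> smooth_fun A f \<and> (\<exists>X. hamiltonian_vf A L f X)"

text \<open>Meaningful for admissible \<open>f\<close> and \<open>g\<close>, in which case the result does not depend on the
  choice of \<open>X\<close>.\<close>

definition poisson_bracket :: "('a, 'e::real_normed_vector) chart set \<Rightarrow>
    ('a \<Rightarrow> 'e gen_vector set) \<Rightarrow> ('a \<Rightarrow> real) \<Rightarrow> ('a \<Rightarrow> real) \<Rightarrow> 'a \<Rightarrow> real" where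
  "poisson_bracket A L f g =
     (let X = (SOME X. hamiltonian_vf A L f X)
      in (\<lambda>p. blinfun_apply (differential A g p) (X p)))"


section \<open>Traces of powers\<close>

definition lin_trace :: "('e::real_vector \<Rightarrow> 'e) \<Rightarrow> real" where
  "lin_trace T =
     (let B = (SOME B::'e set. independent B \<and> span B = UNIV)
      in (\<Sum>b\<in>B. representation B (T b) b))"

definition trace_fun :: "('a, 'e::real_normed_vector) endo_field \<Rightarrow> nat \<Rightarrow> 'a \<Rightarrow> real" where
  "trace_fun r j = (\<lambda>p. (1 / real j) * lin_trace (blinfun_apply (r p) ^^ j))"

end

theory Submission
  imports Defs
begin

text \<open>
  Two facts carry the proof.

  The first is the Lenard relation \<open>r\<^sup>*(d\<phi>\<^sub>j) = d\<phi>\<^sub>j\<^sub>+\<^sub>1\<close>, which holds for every Nijenhuis tensor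
  (\<open>differential_trace_fun_Suc\<close>). In coordinates the vanishing torsion reads
  \<open>(\<partial>\<^bsub>rv\<^esub> r) w - (\<partial>\<^bsub>rw\<^esub> r) v = r ((\<partial>\<^sub>v r) w - (\<partial>\<^sub>w r) v)\<close>. Apply \<open>r\<^sup>k\<close> and take the trace in \<open>w\<close>: by
  cyclicity the second and fourth term have equal traces, and what remains is
  \<open>tr (r\<^sup>k \<partial>\<^bsub>rv\<^esub> r) = tr (r\<^sup>k\<^sup>+\<^sup>1 \<partial>\<^sub>v r)\<close>, that is, \<open>d\<phi>\<^sub>k\<^sub>+\<^sub>1(rv) = d\<phi>\<^sub>k\<^sub>+\<^sub>2(v)\<close>.

  The second is that \<open>L\<close> is isotropic and invariant under \<open>(r, r\<^sup>*)\<close>. If \<open>(X, d\<phi>\<^sub>1)\<close> is a section of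
  \<open>L\<close>, then so is \<open>(r\<^sup>kX, (r\<^sup>*)\<^sup>k d\<phi>\<^sub>1) = (r\<^sup>kX, d\<phi>\<^sub>k\<^sub>+\<^sub>1)\<close>, so all \<open>\<phi>\<^sub>i\<close> are admissible
  (\<open>hamiltonian_vf_trace_fun\<close>). The pairing of \<open>(X, d\<phi>\<^sub>1)\<close> with this section is \<open>2 d\<phi>\<^sub>1(r\<^sup>kX)\<close>, which is therefore
  0 for all \<open>k\<close>. The brackets are such values: \<open>{\<phi>\<^sub>i, \<phi>\<^sub>j} = d\<phi>\<^sub>j(r\<^sup>i\<^sup>-\<^sup>1X) = d\<phi>\<^sub>1(r\<^sup>i\<^sup>+\<^sup>j\<^sup>-\<^sup>2X)\<close>.

  The torsion is a condition on global vector fields, so reading it off at a point takes smooth fields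
  with prescribed value there (\<open>vector_field_exists\<close>), hence bump functions; a calculus of \<open>Ck_on\<close>
  comes before them.
\<close>

section \<open>Finite-dimensional inner product spaces\<close>

text \<open>
  Of an orthonormal basis only the reproducing identity is retained. Bases are passed explicitly
  because the class \<open>euclidean_space\<close>, which would fix one, excludes dimension 0.
\<close>

definition frame :: "'e::real_inner set \<Rightarrow> bool" where
  "frame B \<longleftrightarrow> finite B \<and> (\<forall>v. v = (\<Sum>b\<in>B. (v \<bullet> b) *\<^sub>R b))"

lemma frame_finite: "frame B \<Longrightarrow> finite B"
  by (simp add: frame_def)

lemma frame_expand: "frame B \<Longrightarrow> (\<Sum>b\<in>B. (v \<bullet> b) *\<^sub>R b) = v"
  by (simp add: frame_def)

lemma frame_exists:
  fixes B :: "'e::real_inner set"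
  assumes "finite B" "span B = UNIV"
  shows "\<exists>C::'e set. frame C"
proof -
  obtain C where C: "finite C" "span C = (UNIV :: 'e set)" "pairwise orthogonal C"
    using basis_orthogonal[OF assms(1)] assms(2) by auto
  define D where "D = (\<lambda>c. c /\<^sub>R norm c) ` (C - {0})"
  have fin: "finite D"
    using C by (simp add: D_def)
  have unit: "b \<bullet> b = 1" if b: "b \<in> D" for b
  proof -
    obtain c where "b = c /\<^sub>R norm c" "c \<noteq> 0"
      using b by (auto simp: D_def)
    then have "norm b = 1" by simp
    then show ?thesis by (simp add: norm_eq_1)
  qed
  have orth: "b \<bullet> b' = 0" if "b \<in> D" "b' \<in> D" "b \<noteq> b'" for b b'
    using that C(3) by (clarsimp simp: D_def pairwise_def orthogonal_def) metis
  have D: "(\<Sum>b'\<in>D. (b \<bullet> b') *\<^sub>R b') = b" if "b \<in> D" for b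
  proof -
    have "(\<Sum>b'\<in>D. (b \<bullet> b') *\<^sub>R b') = (\<Sum>b'\<in>D. if b' = b then b else 0)"
      using that unit orth by (intro sum.cong) auto
    then show ?thesis
      using that fin by simp
  qed
  define S where "S = {v::'e. v = (\<Sum>b\<in>D. (v \<bullet> b) *\<^sub>R b)}"
  have "subspace S"
    unfolding S_def subspace_def
    by (auto simp: inner_add_left scaleR_add_left sum.distrib
        simp flip: scaleR_scaleR scaleR_right.sum)
  moreover have "C \<subseteq> S"
  proof
    fix c assume "c \<in> C"
    show "c \<in> S"
    proof (cases "c = 0")
      case True
      then show ?thesis by (simp add: S_def)
    next
      case False
      define b where "b = c /\<^sub>R norm c"
      have "b \<in> S"
        using D[of b] False \<open>c \<in> C\<close> by (auto simp: D_def S_def b_def)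
      then have "norm c *\<^sub>R b \<in> S"
        using \<open>subspace S\<close> by (simp add: subspace_scale)
      then show ?thesis
        using False by (simp add: b_def)
    qed
  qed
  ultimately have "span C \<subseteq> S"
    by (rule span_minimal[rotated])
  then have "frame D"
    using C fin by (auto simp: frame_def S_def)
  then show ?thesis ..
qed

lemma linear_frame_expand:
  assumes "frame B" "linear f"
  shows "(\<Sum>b\<in>B. (v \<bullet> b) *\<^sub>R f b) = f v"
proof -
  have "f v = f (\<Sum>b\<in>B. (v \<bullet> b) *\<^sub>R b)"
    by (simp add: frame_expand assms)
  also have "\<dots> = (\<Sum>b\<in>B. (v \<bullet> b) *\<^sub>R f b)"
    by (simp add: linear_sum linear_scale assms)
  finally show ?thesis by simp
qed

lemma frame_bounded_linear:
  fixes f :: "'e::real_inner \<Rightarrow> 'f::real_normed_vector"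
  assumes "frame (B :: 'e set)" "linear f"
  shows "bounded_linear f"
proof -
  have "bounded_linear (\<lambda>v. \<Sum>b\<in>B. (v \<bullet> b) *\<^sub>R f b)"
    by (intro bounded_linear_sum bounded_linear_scaleR_const bounded_linear_inner_left)
  then show ?thesis
    by (simp add: linear_frame_expand[OF assms])
qed

lemma frame_real: "frame {1::real}"
  by (simp add: frame_def)

section \<open>Calculus of smooth maps\<close>

text \<open>The congruence premise is \<open>Ck_on_cong\<close> for the order \<open>k\<close>, whose inductive proof uses this rule.\<close>

lemma Ck_on_SucI:
  fixes f :: "'e::real_normed_vector \<Rightarrow> 'f::real_normed_vector"
  assumes "open U" "\<And>x. x \<in> U \<Longrightarrow> (f has_derivative D x) (at x)"
    and "\<And>v. Ck_on k U (\<lambda>x. D x v)"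
    and cong: "\<And>f g :: 'e \<Rightarrow> 'f.
      (\<And>x. x \<in> U \<Longrightarrow> f x = g x) \<Longrightarrow> Ck_on k U f \<Longrightarrow> Ck_on k U g"
  shows "Ck_on (Suc k) U f"
proof -
  have D: "frechet_derivative f (at x) = D x" if "x \<in> U" for x
    using frechet_derivative_at[OF assms(2)[OF that]] by simp
  have "Ck_on k U (\<lambda>x. frechet_derivative f (at x) v)" for v
    by (rule cong[of "\<lambda>x. D x v"]) (simp_all add: D assms(3))
  then show ?thesis
    using assms(2) by (auto simp: differentiable_def)
qed

lemma Ck_on_cong:
  assumes "open U" "\<And>x. x \<in> U \<Longrightarrow> f x = g x" "Ck_on k U f"
  shows "Ck_on k U g"
  using assms(2,3)
proof (induction k arbitrary: f g)
  case 0
  then show ?case by (auto cong: continuous_on_cong)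
next
  case (Suc k)
  show ?case
  proof (rule Ck_on_SucI)
    show "(g has_derivative frechet_derivative f (at x)) (at x)" if "x \<in> U" for x
      using that Suc.prems \<open>open U\<close>
      by (metis Ck_on.simps(2) frechet_derivative_works has_derivative_transform_within_open)
  qed (use Suc \<open>open U\<close> in auto)
qed

lemma Ck_onI:
  assumes "open U" "\<And>x. x \<in> U \<Longrightarrow> (f has_derivative D x) (at x)"
    and "\<And>v. Ck_on k U (\<lambda>x. D x v)"
  shows "Ck_on (Suc k) U f"
  using Ck_on_SucI[OF assms] Ck_on_cong[OF assms(1)] by blast

lemma Ck_on_has_derivative:
  "Ck_on (Suc k) U f \<Longrightarrow> x \<in> U \<Longrightarrow> (f has_derivative frechet_derivative f (at x)) (at x)"
  by (simp flip: frechet_derivative_works)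

lemma Ck_on_SucD: "Ck_on (Suc k) U f \<Longrightarrow> Ck_on k U f"
proof (induction k arbitrary: f)
  case 0
  then show ?case
    by (auto intro!: continuous_at_imp_continuous_on differentiable_imp_continuous_within)
next
  case (Suc k)
  then show ?case by (metis Ck_on.simps(2))
qed

lemma Ck_on_subset: "Ck_on k U f \<Longrightarrow> V \<subseteq> U \<Longrightarrow> Ck_on k V f"
  by (induction k arbitrary: f) (auto intro: continuous_on_subset)

lemma Ck_on_Un: "open U \<Longrightarrow> open V \<Longrightarrow> Ck_on k U f \<Longrightarrow> Ck_on k V f \<Longrightarrow> Ck_on k (U \<union> V) f"
  by (induction k arbitrary: f) (auto intro: continuous_on_open_Un)

lemma Ck_on_const: "open U \<Longrightarrow> Ck_on k U (\<lambda>x. c)"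
proof (induction k arbitrary: c)
  case (Suc k)
  then show ?case by (intro Ck_onI[where D = "\<lambda>x v. 0"]) auto
qed simp

lemma Ck_on_linear:
  assumes "open U" "bounded_linear l" "Ck_on k U f"
  shows "Ck_on k U (\<lambda>x. l (f x))"
  using assms(3)
proof (induction k arbitrary: f)
  case 0
  then show ?case by (simp add: bounded_linear.continuous_on[OF assms(2)])
next
  case (Suc k)
  show ?case
  proof (rule Ck_onI)
    show "((\<lambda>x. l (f x)) has_derivative (\<lambda>v. l (frechet_derivative f (at x) v))) (at x)"
      if "x \<in> U" for x
      using bounded_linear.has_derivative[OF assms(2) Ck_on_has_derivative[OF Suc.prems that]] .
  qed (use Suc assms in auto)
qed

lemma Ck_on_add:
  assumes "open U" "Ck_on k U f" "Ck_on k U g"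
  shows "Ck_on k U (\<lambda>x. f x + g x)"
  using assms(2,3)
proof (induction k arbitrary: f g)
  case 0
  then show ?case by (simp add: continuous_on_add)
next
  case (Suc k)
  show ?case
  proof (rule Ck_onI)
    show "((\<lambda>x. f x + g x) has_derivative
        (\<lambda>v. frechet_derivative f (at x) v + frechet_derivative g (at x) v)) (at x)"
      if "x \<in> U" for x
      using has_derivative_add Ck_on_has_derivative Suc.prems that by blast
  qed (use Suc assms in auto)
qed

lemma Ck_on_sum:
  assumes "open U" "\<And>i. i \<in> I \<Longrightarrow> Ck_on k U (f i)"
  shows "Ck_on k U (\<lambda>x. \<Sum>i\<in>I. f i x)"
  using assms(2)
  by (induction I rule: infinite_finite_induct) (auto intro: Ck_on_const Ck_on_add assms(1))

lemma Ck_on_bilinear: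
  assumes "open U" "bounded_bilinear mul" "Ck_on k U f" "Ck_on k U g"
  shows "Ck_on k U (\<lambda>x. mul (f x) (g x))"
  using assms(3,4)
proof (induction k arbitrary: f g)
  case 0
  then show ?case by (simp add: bounded_bilinear.continuous_on[OF assms(2)])
next
  case (Suc k)
  show ?case
  proof (rule Ck_onI)
    show "((\<lambda>x. mul (f x) (g x)) has_derivative
        (\<lambda>v. mul (f x) (frechet_derivative g (at x) v)
            + mul (frechet_derivative f (at x) v) (g x))) (at x)"
      if "x \<in> U" for x
      using bounded_bilinear.FDERIV[OF assms(2) Ck_on_has_derivative[OF Suc.prems(1) that]
          Ck_on_has_derivative[OF Suc.prems(2) that]] .
    have "Ck_on k U f" "Ck_on k U g"
      using Suc.prems Ck_on_SucD by blast+
    then show "Ck_on k U (\<lambda>x. mul (f x) (frechet_derivative g (at x) v)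
            + mul (frechet_derivative f (at x) v) (g x))" for v
      using Suc.prems by (intro Ck_on_add Suc.IH assms(1)) auto
  qed (use assms in auto)
qed

lemma Ck_on_ident: "open U \<Longrightarrow> Ck_on k U (\<lambda>x. x)"
proof (cases k)
  case (Suc n)
  then show "open U \<Longrightarrow> ?thesis"
    by (auto intro!: Ck_onI[where D = "\<lambda>x v. v"] Ck_on_const)
qed simp

text \<open>Expanding the inner derivative in a frame turns the chain rule into a sum of products, to
  which the induction hypothesis applies.\<close>

lemma Ck_on_compose:
  fixes f :: "'e::real_normed_vector \<Rightarrow> 'f::real_inner" and g :: "'f \<Rightarrow> 'g::real_normed_vector"
  assumes "open U" "frame (B :: 'f set)" "f ` U \<subseteq> V" "Ck_on k U f" "Ck_on k V g"
  shows "Ck_on k U (\<lambda>x. g (f x))"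
  using assms(4,5)
proof (induction k arbitrary: g)
  case 0
  then show ?case using assms(3) by (auto intro: continuous_on_compose2)
next
  case (Suc k)
  let ?f' = "\<lambda>x. frechet_derivative f (at x)" and ?g' = "\<lambda>y. frechet_derivative g (at y)"
  show ?case
  proof (rule Ck_onI)
    show "((\<lambda>x. g (f x)) has_derivative (\<lambda>v. \<Sum>b\<in>B. (?f' x v \<bullet> b) *\<^sub>R ?g' (f x) b)) (at x)"
      if "x \<in> U" for x
    proof -
      have g: "(g has_derivative ?g' (f x)) (at (f x))"
        using Suc.prems(2) assms(3) that by (intro Ck_on_has_derivative) auto
      have "((\<lambda>x. g (f x)) has_derivative (\<lambda>v. ?g' (f x) (?f' x v))) (at x)"
        using has_derivative_compose[OF Ck_on_has_derivative[OF Suc.prems(1) that] g] .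
      then show ?thesis
        by (simp add: linear_frame_expand[OF assms(2) has_derivative_linear[OF g]])
    qed
    have "Ck_on k U f"
      using Suc.prems Ck_on_SucD by blast
    then show "Ck_on k U (\<lambda>x. \<Sum>b\<in>B. (?f' x v \<bullet> b) *\<^sub>R ?g' (f x) b)" for v
      using Suc.prems
      by (intro Ck_on_sum Ck_on_bilinear[OF _ bounded_bilinear_scaleR] Suc.IH assms(1)
          Ck_on_linear[OF _ bounded_linear_inner_left]) auto
  qed (use assms in auto)
qed

lemma smooth_on_differentiable:
  "smooth_on U f \<Longrightarrow> x \<in> U \<Longrightarrow> (f has_derivative frechet_derivative f (at x)) (at x)"
  unfolding smooth_on_def by (meson Ck_on_has_derivative)

lemma smooth_on_derivative:
  "smooth_on U f \<Longrightarrow> smooth_on U (\<lambda>x. frechet_derivative f (at x) v)"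
  unfolding smooth_on_def by (metis Ck_on.simps(2))

lemma smooth_on_cong: "open U \<Longrightarrow> (\<And>x. x \<in> U \<Longrightarrow> f x = g x) \<Longrightarrow> smooth_on U f \<Longrightarrow> smooth_on U g"
  unfolding smooth_on_def by (blast intro: Ck_on_cong)

lemma smooth_on_subset: "smooth_on U f \<Longrightarrow> V \<subseteq> U \<Longrightarrow> smooth_on V f"
  unfolding smooth_on_def by (blast intro: Ck_on_subset)

lemma smooth_on_Un:
  "open U \<Longrightarrow> open V \<Longrightarrow> smooth_on U f \<Longrightarrow> smooth_on V f \<Longrightarrow> smooth_on (U \<union> V) f"
  unfolding smooth_on_def by (blast intro: Ck_on_Un)

lemma smooth_on_const: "open U \<Longrightarrow> smooth_on U (\<lambda>x. c)"
  unfolding smooth_on_def by (blast intro: Ck_on_const)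

lemma smooth_on_ident: "open U \<Longrightarrow> smooth_on U (\<lambda>x. x)"
  unfolding smooth_on_def by (blast intro: Ck_on_ident)

lemma smooth_on_linear:
  "open U \<Longrightarrow> bounded_linear l \<Longrightarrow> smooth_on U f \<Longrightarrow> smooth_on U (\<lambda>x. l (f x))"
  unfolding smooth_on_def by (blast intro: Ck_on_linear)

lemma smooth_on_add:
  "open U \<Longrightarrow> smooth_on U f \<Longrightarrow> smooth_on U g \<Longrightarrow> smooth_on U (\<lambda>x. f x + g x)"
  unfolding smooth_on_def by (blast intro: Ck_on_add)

lemma smooth_on_sum:
  "open U \<Longrightarrow> (\<And>i. i \<in> I \<Longrightarrow> smooth_on U (f i)) \<Longrightarrow> smooth_on U (\<lambda>x. \<Sum>i\<in>I. f i x)"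
  unfolding smooth_on_def by (blast intro: Ck_on_sum)

lemma smooth_on_bilinear:
  "open U \<Longrightarrow> bounded_bilinear mul \<Longrightarrow> smooth_on U f \<Longrightarrow> smooth_on U g \<Longrightarrow>
    smooth_on U (\<lambda>x. mul (f x) (g x))"
  unfolding smooth_on_def by (blast intro: Ck_on_bilinear)

lemmas smooth_on_scaleR = smooth_on_bilinear[OF _ bounded_bilinear_scaleR]

lemma smooth_on_compose:
  fixes f :: "'e::real_normed_vector \<Rightarrow> 'f::real_inner"
  assumes "open U" "frame (B :: 'f set)" "f ` U \<subseteq> V" "smooth_on U f" "smooth_on V g"
  shows "smooth_on U (\<lambda>x. g (f x))"
  using assms unfolding smooth_on_def by (blast intro: Ck_on_compose)

text \<open>Smoothness of \<open>R\<close> is tested on fixed vectors only. The general case follows by expanding \<open>Y x\<close>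
  in a frame, since \<open>R x\<close> is linear.\<close>

lemma smooth_on_apply:
  fixes Y :: "'e::real_normed_vector \<Rightarrow> 'f::real_inner"
  assumes "open U" "frame (B :: 'f set)" "\<And>x. x \<in> U \<Longrightarrow> linear (R x)"
    and "\<And>v. smooth_on U (\<lambda>x. R x v)" "smooth_on U Y"
  shows "smooth_on U (\<lambda>x. R x (Y x))"
proof (rule smooth_on_cong)
  show "smooth_on U (\<lambda>x. \<Sum>b\<in>B. (Y x \<bullet> b) *\<^sub>R R x b)"
    by (intro smooth_on_sum smooth_on_scaleR smooth_on_linear[OF _ bounded_linear_inner_left] assms)
qed (simp_all add: assms linear_frame_expand)

section \<open>A smooth bump function\<close>

text \<open>The usual flat function is \<open>flat 0\<close>. The span of the family is closed under differentiation
  (\<open>flat_has_derivative\<close>), which makes smoothness an induction on the order.\<close>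

definition flat :: "nat \<Rightarrow> real \<Rightarrow> real" where
  "flat n t = (if t > 0 then (1 / t) ^ n * exp (- (1 / t)) else 0)"

lemma flat_tendsto_0: "((\<lambda>t. flat n t) \<longlongrightarrow> 0) (at_right 0)"
proof -
  have "((\<lambda>t. inverse t ^ n / exp (inverse t)) \<longlongrightarrow> (0::real)) (at_right 0)"
    by (rule filterlim_compose[OF tendsto_power_div_exp_0 filterlim_inverse_at_top_right])
  moreover have "\<forall>\<^sub>F t in at_right 0. inverse t ^ n / exp (inverse t) = flat n t"
    unfolding eventually_at_right_field
    by (intro exI[of _ 1]) (auto simp: flat_def exp_minus field_simps)
  ultimately show ?thesis
    by (rule Lim_transform_eventually)
qed

lemma flat_has_derivative:
  "(flat n has_real_derivative flat (n + 2) t - n * flat (n + 1) t) (at t)"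
proof (cases t "0::real" rule: linorder_cases)
  case less
  have "((\<lambda>t. 0) has_real_derivative 0) (at t)" by simp
  then have "(flat n has_real_derivative 0) (at t)"
    by (rule has_field_derivative_transform_within_open[of _ _ _ "{..<0}"])
      (use less in \<open>auto simp: flat_def\<close>)
  then show ?thesis using less by (simp add: flat_def)
next
  case greater
  have "((\<lambda>t. (1 / t) ^ n * exp (- (1 / t))) has_real_derivative
      flat (n + 2) t - n * flat (n + 1) t) (at t)"
    using greater
  proof -
    have i: "((\<lambda>t. 1 / t) has_real_derivative - (1 / t)\<^sup>2) (at t)"
      using greater by (auto intro!: derivative_eq_intros simp: power2_eq_square)
    have e: "((\<lambda>t. exp (- (1 / t))) has_real_derivative exp (- (1 / t)) * (1 / t)\<^sup>2) (at t)"
      using DERIV_fun_exp[OF DERIV_minus[OF i]] by simp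
    have "real n * (- u\<^sup>2 * u ^ (n - Suc 0)) * E + E * u\<^sup>2 * u ^ n
        = u ^ (n + 2) * E - n * (u ^ (n + 1) * E)" for u E :: real
      by (cases n) (simp_all add: power2_eq_square algebra_simps)
    from this[of "1 / t" "exp (- (1 / t))"] show ?thesis
      by (intro DERIV_cong[OF DERIV_mult[OF DERIV_power[OF i, of n] e]])
        (simp only: flat_def greater if_True)
  qed
  then show ?thesis
    by (rule has_field_derivative_transform_within_open[of _ _ _ "{0<..}"])
      (use greater in \<open>auto simp: flat_def\<close>)
next
  case equal
  have "((\<lambda>h. (flat n h - flat n 0) / (h - 0)) \<longlongrightarrow> 0) (at 0)"
  proof (rule filterlim_split_at)
    show "((\<lambda>h. (flat n h - flat n 0) / (h - 0)) \<longlongrightarrow> 0) (at_left 0)"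
      by (rule tendsto_eventually)
        (auto simp: eventually_at_left_field flat_def intro!: exI[of _ "-1"])
    have "\<forall>\<^sub>F h in at_right 0. flat (n + 1) h = (flat n h - flat n 0) / (h - 0)"
      unfolding eventually_at_right_field
      by (intro exI[of _ 1]) (auto simp: flat_def field_simps)
    then show "((\<lambda>h. (flat n h - flat n 0) / (h - 0)) \<longlongrightarrow> 0) (at_right 0)"
      by (rule Lim_transform_eventually[OF flat_tendsto_0])
  qed
  then show ?thesis
    using equal by (simp add: has_field_derivative_iff flat_def)
qed

lemma smooth_flat: "smooth_on UNIV (flat n)"
proof -
  have "Ck_on k UNIV (flat n)" for k
  proof (induction k arbitrary: n)
    case 0
    show ?case
      using flat_has_derivative by (auto intro!: DERIV_continuous_on)
  next
    case (Suc k)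
    show ?case
    proof (rule Ck_onI[where D = "\<lambda>t v. v * flat (n + 2) t + (- real n * v) * flat (n + 1) t"])
      show "(flat n has_derivative
          (\<lambda>v. v * flat (n + 2) t + (- real n * v) * flat (n + 1) t)) (at t)" for t
        by (rule has_derivative_eq_rhs[OF flat_has_derivative[unfolded has_field_derivative_def]])
          (auto simp: algebra_simps)
      show "Ck_on k UNIV (\<lambda>t. v * flat (n + 2) t + (- real n * v) * flat (n + 1) t)" for v
        by (intro Ck_on_add Ck_on_linear[OF _ bounded_linear_mult_right] Suc.IH) auto
    qed auto
  qed
  then show ?thesis by (simp add: smooth_on_def)
qed

text \<open>The bump attains its maximum 1 at the centre, so its derivative vanishes there. Hence
  multiplication by it preserves the value and the first derivatives of a field at the centre.\<close>

lemma bump_exists: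
  fixes x0 :: "'e::real_inner"
  assumes "\<epsilon> > 0"
  obtains \<beta> :: "'e \<Rightarrow> real" where "smooth_on UNIV \<beta>" "\<beta> x0 = 1"
    "(\<beta> has_derivative (\<lambda>v. 0)) (at x0)" "\<forall>x. x \<notin> cball x0 \<epsilon> \<longrightarrow> \<beta> x = 0"
proof
  define q where "q = (\<lambda>x::'e. \<epsilon>\<^sup>2 + - ((x + - x0) \<bullet> (x + - x0)))"
  define \<beta> where "\<beta> = (\<lambda>x. flat 0 (q x) / flat 0 (\<epsilon>\<^sup>2))"
  have pos: "flat 0 (\<epsilon>\<^sup>2) > 0"
    using assms by (simp add: flat_def)
  have sq: "smooth_on UNIV q"
    unfolding q_def
    by (intro smooth_on_add smooth_on_const
        smooth_on_linear[OF _ bounded_linear_minus[OF bounded_linear_ident]]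
        smooth_on_bilinear[OF _ bounded_bilinear_inner] smooth_on_ident) auto
  show smooth: "smooth_on UNIV \<beta>"
    unfolding \<beta>_def
    by (rule smooth_on_linear[OF _ bounded_linear_divide])
      (auto intro: smooth_on_compose[OF _ frame_real _ sq smooth_flat[of 0]])
  show "\<beta> x0 = 1"
    using pos by (simp add: \<beta>_def q_def)
  have "\<beta> x \<le> \<beta> x0" for x
  proof -
    have "flat 0 s \<le> flat 0 t" if "s \<le> t" for s t
      using that by (auto simp: flat_def frac_le)
    then show ?thesis
      using pos by (auto simp: \<beta>_def q_def intro!: divide_right_mono)
  qed
  then have "frechet_derivative \<beta> (at x0) = (\<lambda>v. 0)"
    by (intro differential_zero_maxmin[of x0 UNIV \<beta>])
      (use smooth_on_differentiable[OF smooth] in auto)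
  then show "(\<beta> has_derivative (\<lambda>v. 0)) (at x0)"
    using smooth_on_differentiable[OF smooth, of x0] by simp
  show "\<forall>x. x \<notin> cball x0 \<epsilon> \<longrightarrow> \<beta> x = 0"
  proof (intro allI impI)
    fix x assume *: "x \<notin> cball x0 \<epsilon>"
    have "\<epsilon>\<^sup>2 \<le> (norm (x - x0))\<^sup>2"
      using * assms by (intro power_mono) (auto simp: dist_norm norm_minus_commute)
    then show "\<beta> x = 0"
      by (simp add: \<beta>_def q_def flat_def dot_square_norm)
  qed
qed

section \<open>Change of coordinates\<close>

context smooth_manifold
begin

lemma frame_model: obtains B :: "'e set" where "frame B"
  using finite_dimensional frame_exists by blast

lemma chart_inv_left: "c \<in> A \<Longrightarrow> p \<in> fst c \<Longrightarrow> chart_inv c (snd c p) = p"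
  using chart[of c] by (simp add: homeomorphism_def)

lemma chart_inv_right: "c \<in> A \<Longrightarrow> x \<in> chart_image c \<Longrightarrow> snd c (chart_inv c x) = x"
  by (auto simp: chart_inv_left)

lemma chart_inv_dom: "c \<in> A \<Longrightarrow> x \<in> chart_image c \<Longrightarrow> chart_inv c x \<in> fst c"
  using chart[of c] by (auto simp: homeomorphism_def)

lemma open_chart_image: "c \<in> A \<Longrightarrow> open (chart_image c)"
  using chart by blast

lemma open_chart_image_Int:
  assumes "c \<in> A" "open W"
  shows "open (snd c ` (fst c \<inter> W))"
proof -
  have "openin (top_of_set (chart_image c)) (snd c ` (fst c \<inter> W))"
    using chart[OF assms(1)] assms(2)
    by (intro homeomorphism_imp_open_map[of "fst c" _ _ "chart_inv c"]) auto
  then show ?thesis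
    using open_chart_image[OF assms(1)] openin_open_trans by blast
qed

lemma chart_at: "chart_at A p \<in> A" "p \<in> fst (chart_at A p)"
proof -
  have "\<exists>c. c \<in> A \<and> p \<in> fst c"
    using covering by blast
  then have "chart_at A p \<in> A \<and> p \<in> fst (chart_at A p)"
    unfolding chart_at_def by (rule someI_ex)
  then show "chart_at A p \<in> A" "p \<in> fst (chart_at A p)" by auto
qed

lemma coords_at: "coords_at A p \<in> chart_image (chart_at A p)"
  "chart_inv (chart_at A p) (coords_at A p) = p"
  by (simp_all add: coords_at_def chart_at chart_inv_left)

text \<open>Both \<open>to_coord\<close> and \<open>of_coord\<close> are such derivatives, with \<open>chart_at\<close> as one of the charts,
  so that the cocycle rule \<open>trans_deriv_compose\<close> covers all changes of components.\<close>

definition trans_deriv :: "('a, 'e) chart \<Rightarrow> ('a, 'e) chart \<Rightarrow> 'e \<Rightarrow> 'e \<Rightarrow> 'e" where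
  "trans_deriv c d x = frechet_derivative (snd d \<circ> chart_inv c) (at x)"

lemma trans_has_derivative:
  assumes "c \<in> A" "d \<in> A" "p \<in> fst c" "p \<in> fst d"
  shows "((snd d \<circ> chart_inv c) has_derivative trans_deriv c d (snd c p)) (at (snd c p))"
  unfolding trans_deriv_def
  by (rule smooth_on_differentiable[OF transition]) (use assms in auto)

lemma linear_trans_deriv:
  "c \<in> A \<Longrightarrow> d \<in> A \<Longrightarrow> p \<in> fst c \<Longrightarrow> p \<in> fst d \<Longrightarrow> linear (trans_deriv c d (snd c p))"
  using trans_has_derivative has_derivative_linear by blast

lemma trans_deriv_compose:
  assumes "c \<in> A" "d \<in> A" "e \<in> A" "p \<in> fst c" "p \<in> fst d" "p \<in> fst e"
  shows "trans_deriv d e (snd d p) (trans_deriv c d (snd c p) v) = trans_deriv c e (snd c p) v"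
proof -
  let ?f = "snd d \<circ> chart_inv c" and ?g = "snd e \<circ> chart_inv d"
  have "(?g has_derivative trans_deriv d e (snd d p)) (at (?f (snd c p)))"
    using trans_has_derivative[of d e p] assms by (simp add: chart_inv_left)
  with trans_has_derivative[of c d p] assms
  have "((\<lambda>x. ?g (?f x)) has_derivative
      (\<lambda>v. trans_deriv d e (snd d p) (trans_deriv c d (snd c p) v))) (at (snd c p))"
    using has_derivative_compose by blast
  then have "((snd e \<circ> chart_inv c) has_derivative
      (\<lambda>v. trans_deriv d e (snd d p) (trans_deriv c d (snd c p) v))) (at (snd c p))"
    by (rule has_derivative_transform_within_open[OF _ open_chart_image_Int[of c "fst d"]])
      (use assms chart in \<open>auto simp: chart_inv_left\<close>)
  then show ?thesis
    unfolding trans_deriv_def[of c e] by (metis frechet_derivative_at)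
qed

lemma trans_deriv_self:
  assumes "c \<in> A" "p \<in> fst c"
  shows "trans_deriv c c (snd c p) v = v"
proof -
  have "((snd c \<circ> chart_inv c) has_derivative (\<lambda>v. v)) (at (snd c p))"
    by (rule has_derivative_transform_within_open[OF has_derivative_ident open_chart_image[of c]])
      (use assms in \<open>auto simp: chart_inv_left\<close>)
  then show ?thesis
    unfolding trans_deriv_def by (metis frechet_derivative_at)
qed

lemma to_coord_trans: "to_coord A c p = trans_deriv (chart_at A p) c (snd (chart_at A p) p)"
  by (simp add: to_coord_def trans_deriv_def coords_at_def)

lemma of_coord_trans: "of_coord A c p = trans_deriv c (chart_at A p) (snd c p)"
  by (simp add: of_coord_def trans_deriv_def)

lemma linear_to_coord: "c \<in> A \<Longrightarrow> p \<in> fst c \<Longrightarrow> linear (to_coord A c p)"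
  by (simp add: to_coord_trans linear_trans_deriv chart_at)

lemma linear_of_coord: "c \<in> A \<Longrightarrow> p \<in> fst c \<Longrightarrow> linear (of_coord A c p)"
  by (simp add: of_coord_trans linear_trans_deriv chart_at)

lemma to_coord_of_coord:
  "c \<in> A \<Longrightarrow> d \<in> A \<Longrightarrow> p \<in> fst c \<Longrightarrow> p \<in> fst d \<Longrightarrow>
    to_coord A d p (of_coord A c p v) = trans_deriv c d (snd c p) v"
  by (simp add: to_coord_trans of_coord_trans trans_deriv_compose chart_at)

lemma of_coord_to_coord: "c \<in> A \<Longrightarrow> p \<in> fst c \<Longrightarrow> of_coord A c p (to_coord A c p v) = v"
  by (simp add: to_coord_trans of_coord_trans trans_deriv_compose trans_deriv_self chart_at)

lemma to_coord_chart_at: "to_coord A (chart_at A p) p v = v"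
  by (simp add: to_coord_trans trans_deriv_self chart_at)

lemma of_coord_chart_at: "of_coord A (chart_at A p) p v = v"
  by (simp add: of_coord_trans trans_deriv_self chart_at)

section \<open>Fields in coordinates\<close>

lemma linear_endo_rep:
  assumes "c \<in> A" "x \<in> chart_image c"
  shows "linear (endo_rep A c r x)"
proof -
  let ?p = "chart_inv c x"
  have "linear (to_coord A c ?p \<circ> (blinfun_apply (r ?p) \<circ> of_coord A c ?p))"
    by (intro linear_compose linear_to_coord linear_of_coord bounded_linear.linear
        blinfun.bounded_linear_right chart_inv_dom assms)
  then show ?thesis
    by (simp add: endo_rep_def[abs_def] Let_def comp_def)
qed

lemma linear_form_rep:
  assumes "c \<in> A" "x \<in> chart_image c"
  shows "linear (form_rep A c \<alpha> x)"
proof -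
  let ?p = "chart_inv c x"
  have "linear (blinfun_apply (\<alpha> ?p) \<circ> of_coord A c ?p)"
    by (intro linear_compose linear_of_coord bounded_linear.linear
        blinfun.bounded_linear_right chart_inv_dom assms)
  then show ?thesis
    by (simp add: form_rep_def[abs_def] Let_def comp_def)
qed

lemma vf_rep_app_endo:
  "c \<in> A \<Longrightarrow> x \<in> chart_image c \<Longrightarrow>
    vf_rep A c (app_endo r X) x = endo_rep A c r x (vf_rep A c X x)"
  by (simp add: vf_rep_def endo_rep_def app_endo_def Let_def of_coord_to_coord chart_inv_dom)

lemma form_rep_dual_endo:
  "c \<in> A \<Longrightarrow> x \<in> chart_image c \<Longrightarrow>
    form_rep A c (dual_endo r \<alpha>) x v = form_rep A c \<alpha> x (endo_rep A c r x v)"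
  by (simp add: form_rep_def endo_rep_def dual_endo_def Let_def of_coord_to_coord chart_inv_dom)

lemma vf_rep_chart_at: "vf_rep A (chart_at A p) X (coords_at A p) = X p"
  by (simp add: vf_rep_def Let_def coords_at to_coord_chart_at)

lemma endo_rep_chart_at: "endo_rep A (chart_at A p) r (coords_at A p) = blinfun_apply (r p)"
  by (simp add: endo_rep_def Let_def coords_at to_coord_chart_at of_coord_chart_at fun_eq_iff)

lemma smooth_vf_app_endo:
  assumes "smooth_endo A r" "smooth_vf A X"
  shows "smooth_vf A (app_endo r X)"
  unfolding smooth_vf_def
proof
  fix c assume c: "c \<in> A"
  obtain B :: "'e set" where B: "frame B" by (rule frame_model)
  have "smooth_on (chart_image c) (\<lambda>x. endo_rep A c r x (vf_rep A c X x))"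
    by (rule smooth_on_apply[OF open_chart_image[OF c] B linear_endo_rep[OF c]])
      (use assms c in \<open>simp_all add: smooth_endo_def smooth_vf_def\<close>)
  then show "smooth_on (chart_image c) (vf_rep A c (app_endo r X))"
    by (rule smooth_on_cong[OF open_chart_image[OF c], rotated]) (simp add: vf_rep_app_endo c)
qed

lemma smooth_form_dual_endo:
  assumes "smooth_endo A r" "smooth_form A \<alpha>"
  shows "smooth_form A (dual_endo r \<alpha>)"
  unfolding smooth_form_def
proof (intro ballI allI)
  fix c v assume c: "c \<in> A"
  obtain B :: "'e set" where B: "frame B" by (rule frame_model)
  have "smooth_on (chart_image c) (\<lambda>x. form_rep A c \<alpha> x (endo_rep A c r x v))"
    by (rule smooth_on_apply[OF open_chart_image[OF c] B linear_form_rep[OF c]])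
      (use assms c in \<open>simp_all add: smooth_endo_def smooth_form_def\<close>)
  then show "smooth_on (chart_image c) (\<lambda>x. form_rep A c (dual_endo r \<alpha>) x v)"
    by (rule smooth_on_cong[OF open_chart_image[OF c], rotated]) (simp add: form_rep_dual_endo c)
qed

section \<open>Global vector fields with prescribed value at a point\<close>

text \<open>By the Cauchy-Schwarz inequality a ball lies in a set of linear combinations of a frame with
  bounded coefficients. Such a set is compact, being a finite sum of segments.\<close>

lemma compact_cball_model: "compact (cball x (\<epsilon>::real) :: 'e set)"
proof -
  obtain B :: "'e set" where B: "frame B" by (rule frame_model)
  define R where "R = (\<lambda>b::'e. (norm x + \<epsilon>) * norm b)"
  define P where "P = (\<lambda>F. {\<Sum>b\<in>F. t b *\<^sub>R b | t. \<forall>b\<in>F. t b \<in> {- R b..R b}})"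
  have "compact (P F)" if "finite F" for F
    using that
  proof induction
    case empty
    then show ?case by (simp add: P_def)
  next
    case (insert b F)
    have "compact ((\<lambda>t. t *\<^sub>R b) ` {- R b..R b})"
      by (intro compact_continuous_image continuous_intros compact_Icc)
    moreover have "P (insert b F) = {u + w | u w. u \<in> (\<lambda>t. t *\<^sub>R b) ` {- R b..R b} \<and> w \<in> P F}"
      (is "_ = ?S")
    proof
      show "P (insert b F) \<subseteq> ?S"
      proof
        fix y assume "y \<in> P (insert b F)"
        then obtain t where t: "y = (\<Sum>a\<in>insert b F. t a *\<^sub>R a)" "\<forall>a\<in>insert b F. t a \<in> {- R a..R a}"
          unfolding P_def by blast
        then have "y = t b *\<^sub>R b + (\<Sum>a\<in>F. t a *\<^sub>R a)"
          using insert by simp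
        moreover have "t b *\<^sub>R b \<in> (\<lambda>t. t *\<^sub>R b) ` {- R b..R b}"
          using t(2) by blast
        moreover have "(\<Sum>a\<in>F. t a *\<^sub>R a) \<in> P F"
          unfolding P_def using t(2) by blast
        ultimately show "y \<in> ?S" by blast
      qed
      show "?S \<subseteq> P (insert b F)"
      proof
        fix y assume "y \<in> ?S"
        then obtain s t where *: "y = s *\<^sub>R b + (\<Sum>b\<in>F. t b *\<^sub>R b)"
          "s \<in> {- R b..R b}" "\<forall>b\<in>F. t b \<in> {- R b..R b}"
          unfolding P_def by blast
        have "(\<Sum>a\<in>F. t a *\<^sub>R a) = (\<Sum>a\<in>F. (t(b := s)) a *\<^sub>R a)"
          using insert by (intro sum.cong) auto
        then have "y = (\<Sum>a\<in>insert b F. (t(b := s)) a *\<^sub>R a)"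
          using * insert by simp
        moreover have "\<forall>a\<in>insert b F. (t(b := s)) a \<in> {- R a..R a}"
          using * by auto
        ultimately show "y \<in> P (insert b F)"
          unfolding P_def by blast
      qed
    qed
    ultimately show ?case
      using compact_sums[of "(\<lambda>t. t *\<^sub>R b) ` {- R b..R b}" "P F"] insert.IH by simp
  qed
  then have "compact (P B)"
    using B by (simp add: frame_finite)
  moreover have "cball x \<epsilon> \<subseteq> P B"
  proof
    fix y assume y: "y \<in> cball x \<epsilon>"
    have "norm y \<le> norm x + norm (y - x)"
      by (rule norm_triangle_sub)
    then have "norm y \<le> norm x + \<epsilon>"
      using y by (simp add: dist_norm norm_minus_commute)
    then have "\<bar>y \<bullet> b\<bar> \<le> R b" for b
      unfolding R_def by (intro order_trans[OF Cauchy_Schwarz_ineq2] mult_right_mono) auto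
    then show "y \<in> P B"
      unfolding P_def using frame_expand[OF B, of y]
      by (intro CollectI exI[of _ "\<lambda>b. y \<bullet> b"]) (auto simp: abs_le_iff minus_le_iff)
  qed
  ultimately show ?thesis
    by (metis closed_cball compact_Int_closed inf.absorb_iff2)
qed

text \<open>In the chart at \<open>p\<close> the field has constant components multiplied by a bump.
  It is smooth across the boundary of the chart since the bump vanishes outside a ball, which is
  compact in \<open>M\<close> and hence closed in this Hausdorff space.\<close>

lemma vector_field_exists:
  fixes p :: 'a and v :: 'e
  obtains X \<beta> where "smooth_vf A X" "\<beta> (coords_at A p) = 1"
    "(\<beta> has_derivative (\<lambda>v. 0)) (at (coords_at A p))"
    "\<forall>x\<in>chart_image (chart_at A p). vf_rep A (chart_at A p) X x = \<beta> x *\<^sub>R v"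
proof -
  define c where "c = chart_at A p"
  define x0 where "x0 = coords_at A p"
  have c: "c \<in> A" by (simp add: c_def chart_at)
  obtain \<epsilon> where \<epsilon>: "\<epsilon> > 0" "cball x0 \<epsilon> \<subseteq> chart_image c"
    using open_contains_cball[THEN iffD1, rule_format, OF open_chart_image[OF c], of x0]
      coords_at(1)[of p] by (auto simp only: c_def x0_def)
  obtain \<beta> :: "'e \<Rightarrow> real" where \<beta>: "smooth_on UNIV \<beta>" "\<beta> x0 = 1"
    "(\<beta> has_derivative (\<lambda>v. 0)) (at x0)" "\<forall>x. x \<notin> cball x0 \<epsilon> \<longrightarrow> \<beta> x = 0"
    using bump_exists[OF \<epsilon>(1), of x0] by metis
  define X where "X = (\<lambda>q. if q \<in> fst c then \<beta> (snd c q) *\<^sub>R of_coord A c q v else 0)"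
  define K where "K = chart_inv c ` cball x0 \<epsilon>"
  have "compact K"
    unfolding K_def
  proof (rule compact_continuous_image[OF _ compact_cball_model])
    show "continuous_on (cball x0 \<epsilon>) (chart_inv c)"
      using chart[OF c] \<epsilon>(2) by (blast intro: continuous_on_subset homeomorphism_cont2)
  qed
  then have "open (- K)"
    by (intro open_Compl compact_imp_closed)
  have K: "K \<subseteq> fst c"
    using \<epsilon>(2) chart_inv_dom[OF c] unfolding K_def by blast
  have rep: "vf_rep A d X x =
      \<beta> (snd c (chart_inv d x)) *\<^sub>R trans_deriv c d (snd c (chart_inv d x)) v"
    if "d \<in> A" "x \<in> chart_image d" "chart_inv d x \<in> fst c" for d x
    using that c chart_inv_dom[OF that(1,2)]
    by (simp add: vf_rep_def Let_def X_def linear_scale[OF linear_to_coord] to_coord_of_coord)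
  have "smooth_vf A X"
    unfolding smooth_vf_def
  proof
    fix d assume d: "d \<in> A"
    obtain B :: "'e set" where B: "frame B" by (rule frame_model)
    define U where "U = snd d ` (fst d \<inter> fst c)"
    define V where "V = snd c ` (fst c \<inter> fst d)"
    define W where "W = snd d ` (fst d \<inter> - K)"
    have opens: "open U" "open V" "open W"
      using chart[OF c] chart[OF d] \<open>open (- K)\<close>
      unfolding U_def V_def W_def by (simp_all only: open_chart_image_Int[OF c] open_chart_image_Int[OF d])
    have "smooth_on V (\<lambda>y. \<beta> y *\<^sub>R trans_deriv c d y v)"
      unfolding trans_deriv_def
    proof (rule smooth_on_scaleR[OF opens(2)])
      show "smooth_on V \<beta>" by (rule smooth_on_subset[OF \<beta>(1)]) simp
      show "smooth_on V (\<lambda>y. frechet_derivative (snd d \<circ> chart_inv c) (at y) v)"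
        unfolding V_def by (rule smooth_on_derivative[OF transition[OF c d]])
    qed
    moreover have "smooth_on U (snd c \<circ> chart_inv d)"
      unfolding U_def by (rule transition[OF d c])
    moreover have "(snd c \<circ> chart_inv d) ` U \<subseteq> V"
      using d by (auto simp: U_def V_def chart_inv_left)
    ultimately have "smooth_on U (\<lambda>x. \<beta> ((snd c \<circ> chart_inv d) x) *\<^sub>R
        trans_deriv c d ((snd c \<circ> chart_inv d) x) v)"
      by (intro smooth_on_compose[OF opens(1) B, of "snd c \<circ> chart_inv d" V
            "\<lambda>y. \<beta> y *\<^sub>R trans_deriv c d y v"])
    then have "smooth_on U (vf_rep A d X)"
      by (rule smooth_on_cong[OF opens(1), rotated])
        (use d in \<open>auto simp: U_def chart_inv_left rep\<close>)
    moreover have "smooth_on W (vf_rep A d X)"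
    proof (rule smooth_on_cong[OF opens(3) _ smooth_on_const[OF opens(3)]])
      fix x assume "x \<in> W"
      then obtain q where q: "x = snd d q" "q \<in> fst d" "q \<notin> K"
        by (auto simp: W_def)
      have "X q = 0"
      proof (cases "q \<in> fst c")
        case True
        have "snd c q \<notin> cball x0 \<epsilon>"
        proof
          assume "snd c q \<in> cball x0 \<epsilon>"
          from imageI[OF this, of "chart_inv c"] show False
            using q(3) True by (simp add: K_def chart_inv_left[OF c])
        qed
        then show ?thesis by (simp add: X_def \<beta>(4))
      qed (simp add: X_def)
      then show "0 = vf_rep A d X x"
        using q d by (simp add: vf_rep_def Let_def chart_inv_left linear_0[OF linear_to_coord])
    qed
    moreover have "chart_image d = U \<union> W"
      using K by (auto simp: U_def W_def)
    ultimately show "smooth_on (chart_image d) (vf_rep A d X)"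
      using smooth_on_Un[OF opens(1,3)] by simp
  qed
  moreover have "vf_rep A c X x = \<beta> x *\<^sub>R v" if "x \<in> chart_image c" for x
    using that c rep[of c x] chart_inv_dom[of c x] chart_inv_right[of c x]
      trans_deriv_self[of c "chart_inv c x"] by simp
  ultimately show thesis
    using that[of X \<beta>] \<beta>(2,3) by (simp add: c_def x0_def)
qed

text \<open>The Nijenhuis torsion is evaluated on fields whose components are constant up to first order
  at \<open>p\<close>, so that all derivatives fall on the components of \<open>r\<close>.\<close>

lemma nijenhuis_in_coordinates:
  assumes "smooth_endo A r" "nijenhuis A r"
  defines "dr \<equiv> \<lambda>p u w.
    frechet_derivative (\<lambda>x. endo_rep A (chart_at A p) r x w) (at (coords_at A p)) u"
  shows "dr p (r p v) w - dr p (r p w) v = r p (dr p v w - dr p w v)"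
proof -
  define c where "c = chart_at A p"
  define x0 where "x0 = coords_at A p"
  have c: "c \<in> A" and x0: "x0 \<in> chart_image c"
    using coords_at(1)[of p] by (auto simp: c_def x0_def chart_at)
  obtain X \<beta> where X: "smooth_vf A X" "\<beta> x0 = 1" "(\<beta> has_derivative (\<lambda>v. 0)) (at x0)"
    "\<forall>x\<in>chart_image c. vf_rep A c X x = \<beta> x *\<^sub>R v"
    using vector_field_exists[of p v] unfolding c_def x0_def by metis
  obtain Y \<gamma> where Y: "smooth_vf A Y" "\<gamma> x0 = 1" "(\<gamma> has_derivative (\<lambda>v. 0)) (at x0)"
    "\<forall>x\<in>chart_image c. vf_rep A c Y x = \<gamma> x *\<^sub>R w"
    using vector_field_exists[of p w] unfolding c_def x0_def by metis
  have deriv: "frechet_derivative (vf_rep A c Z) (at x0) u = 0"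
    "frechet_derivative (vf_rep A c (app_endo r Z)) (at x0) u = dr p u z" "Z p = z"
    if Z: "\<zeta> x0 = 1" "(\<zeta> has_derivative (\<lambda>v. 0)) (at x0)"
      "\<forall>x\<in>chart_image c. vf_rep A c Z x = \<zeta> x *\<^sub>R z" for Z \<zeta> u z
  proof -
    have "((\<lambda>x. \<zeta> x *\<^sub>R z) has_derivative (\<lambda>u. 0)) (at x0)"
      using has_derivative_scaleR[OF Z(2) has_derivative_const[of z]] by simp
    then have "(vf_rep A c Z has_derivative (\<lambda>u. 0)) (at x0)"
      by (rule has_derivative_transform_within_open[OF _ open_chart_image[OF c] x0])
        (simp add: Z)
    then show "frechet_derivative (vf_rep A c Z) (at x0) u = 0"
      by (metis frechet_derivative_at)
    have "((\<lambda>x. endo_rep A c r x z) has_derivative (\<lambda>u. dr p u z)) (at x0)"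
      unfolding dr_def using assms(1) c x0
      by (auto simp: smooth_endo_def c_def x0_def intro: smooth_on_differentiable)
    from has_derivative_scaleR[OF Z(2) this]
    have "((\<lambda>x. \<zeta> x *\<^sub>R endo_rep A c r x z) has_derivative (\<lambda>u. dr p u z)) (at x0)"
      by (simp add: Z)
    then have "(vf_rep A c (app_endo r Z) has_derivative (\<lambda>u. dr p u z)) (at x0)"
      by (rule has_derivative_transform_within_open[OF _ open_chart_image[OF c] x0])
        (simp add: c Z vf_rep_app_endo linear_scale[OF linear_endo_rep])
    then show "frechet_derivative (vf_rep A c (app_endo r Z)) (at x0) u = dr p u z"
      by (metis frechet_derivative_at)
    show "Z p = z"
      using Z(1) bspec[OF Z(3) x0] vf_rep_chart_at[of p Z] by (simp add: c_def x0_def)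
  qed
  note dX = deriv[OF X(2-4)] and dY = deriv[OF Y(2-4)]
  have app: "app_endo r Z p = r p (Z p)" for Z
    by (simp add: app_endo_def)
  have "lie_bracket A (app_endo r X) (app_endo r Y) p
           - blinfun_apply (r p)
               (lie_bracket A (app_endo r X) Y p + lie_bracket A X (app_endo r Y) p
              - blinfun_apply (r p) (lie_bracket A X Y p)) = 0"
    using assms(2) X(1) Y(1) unfolding nijenhuis_def by blast
  then show ?thesis
    by (simp add: lie_bracket_def Let_def dX dY app flip: c_def x0_def)
qed

end

section \<open>Traces\<close>

text \<open>Here \<open>l\<close> collects the coordinate functionals of the basis chosen in \<open>lin_trace\<close>. In this form the
  trace is visibly a sum of bounded linear functionals of the values of \<open>T\<close>.\<close>

lemma lin_trace_dual_basis:
  fixes F :: "'e::real_inner set"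
  assumes "frame F"
  shows "\<exists>(B :: 'e set) (l :: 'e \<Rightarrow> 'e \<Rightarrow> real). (\<forall>b. bounded_linear (l b)) \<and>
    (\<forall>v. (\<Sum>b\<in>B. l b v *\<^sub>R b) = v) \<and> (\<forall>T. lin_trace T = (\<Sum>b\<in>B. l b (T b)))"
proof -
  define B where "B = (SOME B::'e set. independent B \<and> span B = UNIV)"
  have "\<exists>B::'e set. independent B \<and> span B = UNIV"
    using maximal_independent_subset[of "UNIV :: 'e set"] by (metis top.extremum_uniqueI)
  from someI_ex[OF this] have B: "independent B" "span B = UNIV"
    unfolding B_def by auto
  have "v \<in> span F" for v
  proof -
    have "(\<Sum>b\<in>F. (v \<bullet> b) *\<^sub>R b) \<in> span F"
      by (intro span_sum span_scale span_base)
    then show ?thesis by (simp add: frame_expand assms)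
  qed
  then have fin: "finite B"
    using independent_span_bound[OF frame_finite[OF assms] B(1)] by blast
  define l where "l = (\<lambda>b v. representation B v b)"
  have "linear (l b)" for b
    unfolding l_def
    by (intro linearI) (simp_all add: representation_add representation_scale B)
  then have "bounded_linear (l b)" for b
    using assms frame_bounded_linear by blast
  moreover have "(\<Sum>b\<in>B. l b v *\<^sub>R b) = v" for v
    unfolding l_def by (rule sum_representation_eq) (use B fin in auto)
  moreover have "lin_trace T = (\<Sum>b\<in>B. l b (T b))" for T
    unfolding lin_trace_def B_def[symmetric] l_def by simp
  ultimately show ?thesis
    by blast
qed

lemma lin_trace_cyclic:
  fixes S T :: "'e::real_inner \<Rightarrow> 'e"
  assumes F: "frame (F :: 'e set)" and S: "linear S" and T: "linear T"
  shows "lin_trace (\<lambda>v. S (T v)) = lin_trace (\<lambda>v. T (S v))"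
proof -
  obtain B :: "'e set" and l :: "'e \<Rightarrow> 'e \<Rightarrow> real" where
    l: "\<And>b. bounded_linear (l b)" "\<And>v. (\<Sum>b\<in>B. l b v *\<^sub>R b) = v"
    "\<And>T. lin_trace T = (\<Sum>b\<in>B. l b (T b))"
    using lin_trace_dual_basis[OF F] by blast
  have expand: "lin_trace (\<lambda>v. S (T v)) = (\<Sum>b\<in>B. \<Sum>c\<in>B. l c (T b) * l b (S c))"
    if S: "linear S" for S T
  proof -
    have "l b (S (T b)) = (\<Sum>c\<in>B. l c (T b) * l b (S c))" for b
    proof -
      have lin: "linear (l b)"
        using l(1) bounded_linear.linear by blast
      have "l b (S (T b)) = l b (S (\<Sum>c\<in>B. l c (T b) *\<^sub>R c))"
        by (simp add: l(2))
      also have "\<dots> = (\<Sum>c\<in>B. l c (T b) * l b (S c))"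
        by (simp add: linear_sum[OF S] linear_scale[OF S] linear_sum[OF lin] linear_scale[OF lin])
      finally show ?thesis .
    qed
    then show ?thesis by (simp add: l(3))
  qed
  show ?thesis
    unfolding expand[OF S] expand[OF T]
    by (subst sum.swap) (simp add: mult.commute)
qed

lemma lin_trace_sum:
  fixes F :: "'e::real_inner set"
  assumes "frame F"
  shows "lin_trace (\<lambda>v. \<Sum>i\<in>I. T i v :: 'e) = (\<Sum>i\<in>I. lin_trace (T i))"
proof -
  obtain B :: "'e set" and l :: "'e \<Rightarrow> 'e \<Rightarrow> real" where
    l: "\<And>b. bounded_linear (l b)" "\<And>v. (\<Sum>b\<in>B. l b v *\<^sub>R b) = v"
    "\<And>T. lin_trace T = (\<Sum>b\<in>B. l b (T b))"
    using lin_trace_dual_basis[OF assms] by blast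
  show ?thesis
    unfolding l(3) by (subst sum.swap) (simp add: linear_sum[OF bounded_linear.linear[OF l(1)]])
qed

lemma lin_trace_diff:
  fixes F :: "'e::real_inner set"
  assumes "frame F"
  shows "lin_trace (\<lambda>v. S v - T v :: 'e) = lin_trace S - lin_trace T"
proof -
  obtain B :: "'e set" and l :: "'e \<Rightarrow> 'e \<Rightarrow> real" where
    l: "\<And>b. bounded_linear (l b)" "\<And>v. (\<Sum>b\<in>B. l b v *\<^sub>R b) = v"
    "\<And>T. lin_trace T = (\<Sum>b\<in>B. l b (T b))"
    using lin_trace_dual_basis[OF assms] by blast
  show ?thesis
    unfolding l(3) by (simp add: linear_diff[OF bounded_linear.linear[OF l(1)]] sum_subtractf)
qed

lemma linear_funpow: "linear (T :: 'e::real_vector \<Rightarrow> 'e) \<Longrightarrow> linear (T ^^ k)"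
proof (induction k)
  case 0
  then show ?case by (simp add: linear_id[unfolded id_def] id_def)
next
  case (Suc k)
  then show ?case
    unfolding funpow.simps by (intro linear_compose)
qed

lemma smooth_on_lin_trace_power:
  fixes R :: "'e::real_inner \<Rightarrow> 'e \<Rightarrow> 'e"
  assumes F: "frame (F :: 'e set)" and U: "open U" "\<And>x. x \<in> U \<Longrightarrow> linear (R x)"
    and R: "\<And>v. smooth_on U (\<lambda>x. R x v)"
  shows "smooth_on U (\<lambda>x. lin_trace (R x ^^ k))"
proof -
  obtain B :: "'e set" and l :: "'e \<Rightarrow> 'e \<Rightarrow> real" where
    l: "\<And>b. bounded_linear (l b)" "\<And>v. (\<Sum>b\<in>B. l b v *\<^sub>R b) = v"
    "\<And>T. lin_trace T = (\<Sum>b\<in>B. l b (T b))"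
    using lin_trace_dual_basis[OF F] by blast
  have "smooth_on U (\<lambda>x. (R x ^^ k) v)" for v
  proof (induction k)
    case 0
    show ?case using U by (simp add: smooth_on_const)
  next
    case (Suc k)
    then show ?case using smooth_on_apply[OF U(1) F U(2) R] by simp
  qed
  then show ?thesis
    unfolding l(3) by (intro smooth_on_sum smooth_on_linear[OF U(1) l(1)] U(1))
qed

text \<open>The product rule when \<open>R\<close> is differentiable on fixed vectors only, by the same expansion as in
  \<open>smooth_on_apply\<close>.\<close>

lemma has_derivative_apply:
  fixes R :: "'e::real_normed_vector \<Rightarrow> 'f::real_inner \<Rightarrow> 'f"
  assumes F: "frame (F :: 'f set)" and U: "open U" "x0 \<in> U" "\<And>x. x \<in> U \<Longrightarrow> linear (R x)"
    and R: "\<And>v. ((\<lambda>x. R x v) has_derivative (\<lambda>u. R' u v)) (at x0)"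
    and lin: "\<And>u. linear (R' u)"
    and Y: "(Y has_derivative Y') (at x0)"
  shows "((\<lambda>x. R x (Y x)) has_derivative (\<lambda>u. R' u (Y x0) + R x0 (Y' u))) (at x0)"
proof -
  have "((\<lambda>x. \<Sum>b\<in>F. (Y x \<bullet> b) *\<^sub>R R x b) has_derivative
      (\<lambda>u. \<Sum>b\<in>F. (Y x0 \<bullet> b) *\<^sub>R R' u b + (Y' u \<bullet> b) *\<^sub>R R x0 b)) (at x0)"
    by (intro has_derivative_sum has_derivative_scaleR R has_derivative_inner_left Y)
  then have "((\<lambda>x. \<Sum>b\<in>F. (Y x \<bullet> b) *\<^sub>R R x b) has_derivative
      (\<lambda>u. R' u (Y x0) + R x0 (Y' u))) (at x0)"
    by (simp add: sum.distrib linear_frame_expand[OF F] lin U)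
  then show ?thesis
    by (rule has_derivative_transform_within_open[OF _ U(1,2)])
      (simp add: linear_frame_expand[OF F] U)
qed

text \<open>The Leibniz rule gives \<open>k + 1\<close> summands \<open>R\<^sup>i R' R\<^sup>j\<close> with \<open>i + j = k\<close>. By cyclicity they all
  have the same trace.\<close>

lemma has_derivative_lin_trace_power:
  fixes R :: "'e::real_inner \<Rightarrow> 'e \<Rightarrow> 'e"
  assumes F: "frame (F :: 'e set)" and U: "open U" "x0 \<in> U" "\<And>x. x \<in> U \<Longrightarrow> linear (R x)"
    and R: "\<And>v. ((\<lambda>x. R x v) has_derivative (\<lambda>u. R' u v)) (at x0)"
    and lin: "\<And>u. linear (R' u)"
  shows "((\<lambda>x. lin_trace (R x ^^ Suc k)) has_derivative
      (\<lambda>u. real (Suc k) * lin_trace (\<lambda>w. (R x0 ^^ k) (R' u w)))) (at x0)"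
proof -
  obtain B :: "'e set" and l :: "'e \<Rightarrow> 'e \<Rightarrow> real" where
    l: "\<And>b. bounded_linear (l b)" "\<And>v. (\<Sum>b\<in>B. l b v *\<^sub>R b) = v"
    "\<And>T. lin_trace T = (\<Sum>b\<in>B. l b (T b))"
    using lin_trace_dual_basis[OF F] by blast
  let ?T = "R x0"
  have T: "linear ?T" using U by blast
  have "((\<lambda>x. (R x ^^ Suc k) v) has_derivative
      (\<lambda>u. \<Sum>i\<le>k. (?T ^^ (k - i)) (R' u ((?T ^^ i) v)))) (at x0)" for v
  proof (induction k)
    case 0
    show ?case using R by simp
  next
    case (Suc k)
    have "((\<lambda>x. R x ((R x ^^ Suc k) v)) has_derivative (\<lambda>u. R' u ((?T ^^ Suc k) v) +
        ?T (\<Sum>i\<le>k. (?T ^^ (k - i)) (R' u ((?T ^^ i) v))))) (at x0)"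
      by (rule has_derivative_apply[OF F U R lin Suc.IH])
    moreover have "(\<lambda>u. R' u ((?T ^^ Suc k) v) +
        ?T (\<Sum>i\<le>k. (?T ^^ (k - i)) (R' u ((?T ^^ i) v))))
        = (\<lambda>u. \<Sum>i\<le>Suc k. (?T ^^ (Suc k - i)) (R' u ((?T ^^ i) v)))"
      by (simp add: linear_sum[OF T] Suc_diff_le add.commute)
    moreover have "(\<lambda>x. (R x ^^ Suc (Suc k)) v) = (\<lambda>x. R x ((R x ^^ Suc k) v))"
      by simp
    ultimately show ?case by (simp only:)
  qed
  then have "((\<lambda>x. lin_trace (R x ^^ Suc k)) has_derivative
      (\<lambda>u. lin_trace (\<lambda>v. \<Sum>i\<le>k. (?T ^^ (k - i)) (R' u ((?T ^^ i) v))))) (at x0)"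
    unfolding l(3) by (intro has_derivative_sum bounded_linear.has_derivative[OF l(1)])
  moreover have "lin_trace (\<lambda>v. (?T ^^ (k - i)) (R' u ((?T ^^ i) v)))
      = lin_trace (\<lambda>w. (?T ^^ k) (R' u w))" if "i \<le> k" for i u
  proof -
    have "linear (\<lambda>v. (?T ^^ (k - i)) (R' u v))"
      using linear_compose[OF lin linear_funpow[OF T]] by (simp add: comp_def)
    from lin_trace_cyclic[OF F this linear_funpow[OF T, of i]]
    have "lin_trace (\<lambda>v. (?T ^^ (k - i)) (R' u ((?T ^^ i) v)))
      = lin_trace (\<lambda>v. (?T ^^ i) ((?T ^^ (k - i)) (R' u v)))" .
    also have "(\<lambda>v. (?T ^^ i) ((?T ^^ (k - i)) (R' u v))) = (\<lambda>w. (?T ^^ k) (R' u w))"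
      using that by (simp flip: funpow_add comp_apply[of "?T ^^ i"])
    finally show ?thesis .
  qed
  ultimately show ?thesis
    by (simp add: lin_trace_sum[OF F])
qed

text \<open>Composing the torsion identity with \<open>T\<^sup>k\<close> and taking the trace in \<open>w\<close>, the two terms in which
  \<open>w\<close> is the direction of differentiation are \<open>tr (T\<^sup>k S T)\<close> and \<open>tr (T\<^sup>k\<^sup>+\<^sup>1 S)\<close> with
  \<open>S w = N w v\<close>. By cyclicity they cancel.\<close>

lemma torsion_free_trace:
  fixes T :: "'e::real_inner \<Rightarrow> 'e"
  assumes F: "frame (F :: 'e set)" and T: "linear T" and N: "\<And>v. linear (\<lambda>u. N u v)"
    and torsion: "\<And>w. N (T v) w - N (T w) v = T (N v w - N w v)"
  shows "lin_trace (\<lambda>w. (T ^^ k) (N (T v) w)) = lin_trace (\<lambda>w. (T ^^ Suc k) (N v w))"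
proof -
  have Tk: "linear (T ^^ k)" by (rule linear_funpow[OF T])
  have "linear (\<lambda>w. (T ^^ k) (N w v))"
    using linear_compose[OF N Tk] by (simp add: comp_def)
  from lin_trace_cyclic[OF F this T]
  have cancel: "lin_trace (\<lambda>w. (T ^^ k) (N (T w) v)) = lin_trace (\<lambda>w. (T ^^ Suc k) (N w v))"
    by simp
  have "(\<lambda>w. (T ^^ k) (N (T v) w) - (T ^^ k) (N (T w) v))
      = (\<lambda>w. (T ^^ Suc k) (N v w) - (T ^^ Suc k) (N w v))"
  proof
    fix w
    have "(T ^^ k) (N (T v) w - N (T w) v) = (T ^^ k) (T (N v w - N w v))"
      by (simp add: torsion)
    then show "(T ^^ k) (N (T v) w) - (T ^^ k) (N (T w) v)
        = (T ^^ Suc k) (N v w) - (T ^^ Suc k) (N w v)"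
      by (simp add: linear_diff[OF T] linear_diff[OF Tk] funpow_swap1 )
  qed
  from arg_cong[OF this, of lin_trace] cancel show ?thesis
    by (simp only: lin_trace_diff[OF F])
qed

section \<open>The functions \<open>\<phi>\<^sub>j\<close> on the manifold\<close>

context smooth_manifold
begin

text \<open>The trace is invariant under the change of components, by cyclicity. So \<open>\<phi>\<^sub>j\<close> can be computed in any
  chart, where it depends smoothly on the point.\<close>

lemma trace_fun_in_chart:
  assumes "c \<in> A" "x \<in> chart_image c"
  shows "trace_fun r j (chart_inv c x) = (1 / real j) * lin_trace (endo_rep A c r x ^^ j)"
proof -
  obtain F :: "'e set" where F: "frame F" by (rule frame_model)
  define p where "p = chart_inv c x"
  have p: "p \<in> fst c" using assms by (simp add: p_def chart_inv_dom)
  let ?to = "to_coord A c p" and ?of = "of_coord A c p" and ?T = "blinfun_apply (r p)"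
  have T: "linear ?T" by (simp add: bounded_linear.linear blinfun.bounded_linear_right)
  have to: "?to (?of v) = v" for v
    using assms p by (simp add: to_coord_of_coord trans_deriv_self)
  have "(endo_rep A c r x ^^ j) v = ?to ((?T ^^ j) (?of v))" for v
    using assms(1) p
    by (induction j) (simp_all add: to endo_rep_def Let_def of_coord_to_coord flip: p_def)
  then have "lin_trace (endo_rep A c r x ^^ j) = lin_trace (\<lambda>v. ?to ((?T ^^ j) (?of v)))"
    by (intro arg_cong[of _ _ lin_trace] ext)
  also have "\<dots> = lin_trace (\<lambda>v. (?T ^^ j) (?of (?to v)))"
    using lin_trace_cyclic[OF F linear_to_coord, of c p "\<lambda>v. (?T ^^ j) (?of v)"] assms(1) p
      linear_compose[OF linear_of_coord linear_funpow[OF T], of c p j]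
    by (simp add: comp_def)
  also have "\<dots> = lin_trace (?T ^^ j)"
    using assms(1) p by (simp add: of_coord_to_coord)
  finally show ?thesis by (simp add: trace_fun_def p_def)
qed

lemma smooth_fun_trace_fun:
  assumes "smooth_endo A r"
  shows "smooth_fun A (trace_fun r j)"
  unfolding smooth_fun_def
proof
  fix c assume c: "c \<in> A"
  obtain F :: "'e set" where F: "frame F" by (rule frame_model)
  have "smooth_on (chart_image c) (\<lambda>x. (1 / real j) * lin_trace (endo_rep A c r x ^^ j))"
    using c assms
    by (intro smooth_on_linear[OF _ bounded_linear_mult_right] smooth_on_lin_trace_power[OF F]
        open_chart_image linear_endo_rep) (auto simp: smooth_endo_def)
  then show "smooth_on (chart_image c) (trace_fun r j \<circ> chart_inv c)"
    by (rule smooth_on_cong[OF open_chart_image[OF c], rotated])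
      (simp add: trace_fun_in_chart[OF c])
qed

text \<open>The Lenard relation. In the chart at \<open>p\<close> one has \<open>d\<phi>\<^sub>k\<^sub>+\<^sub>1(v) = tr (r\<^sup>k R' v)\<close>, where \<open>R' v\<close> is the
  derivative of the components of \<open>r\<close> in the direction \<open>v\<close>. So \<open>torsion_free_trace\<close> is the claim.\<close>

lemma differential_trace_fun_Suc:
  assumes r: "smooth_endo A r" "nijenhuis A r"
  shows "differential A (trace_fun r (Suc (Suc k))) = dual_endo r (differential A (trace_fun r (Suc k)))"
proof
  fix p
  obtain F :: "'e set" where F: "frame F" by (rule frame_model)
  define c where "c = chart_at A p"
  define x0 where "x0 = coords_at A p"
  have c: "c \<in> A" and x0: "x0 \<in> chart_image c"
    using coords_at(1)[of p] by (auto simp: c_def x0_def chart_at)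
  define R where "R = endo_rep A c r"
  define R' where "R' = (\<lambda>u w. frechet_derivative (\<lambda>x. R x w) (at x0) u)"
  let ?T = "blinfun_apply (r p)"
  have T: "R x0 = ?T"
    unfolding R_def x0_def c_def by (rule endo_rep_chart_at)
  have lin: "linear (R x)" if "x \<in> chart_image c" for x
    unfolding R_def by (rule linear_endo_rep[OF c that])
  have deriv: "((\<lambda>x. R x v) has_derivative (\<lambda>u. R' u v)) (at x0)" for v
    unfolding R'_def R_def using r(1) c x0
    by (auto simp: smooth_endo_def intro: smooth_on_differentiable)
  \<comment> \<open>\<open>R x\<close> is linear for \<open>x\<close> in the chart, which passes to the derivatives at \<open>x0\<close> since these are
    unique.\<close>
  have lin': "linear (R' u)" for u
  proof (rule linearI)
    fix v w s
    have "((\<lambda>x. R x (v + w)) has_derivative (\<lambda>u. R' u v + R' u w)) (at x0)"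
      by (rule has_derivative_transform_within_open[OF has_derivative_add[OF deriv deriv]
            open_chart_image[OF c] x0]) (simp add: linear_add[OF lin])
    then show "R' u (v + w) = R' u v + R' u w"
      using has_derivative_unique[OF deriv] by metis
    have "((\<lambda>x. R x (s *\<^sub>R v)) has_derivative (\<lambda>u. s *\<^sub>R R' u v)) (at x0)"
      by (rule has_derivative_transform_within_open[OF has_derivative_scaleR_right[OF deriv]
            open_chart_image[OF c] x0]) (simp add: linear_scale[OF lin])
    then show "R' u (s *\<^sub>R v) = s *\<^sub>R R' u v"
      using has_derivative_unique[OF deriv] by metis
  qed
  have d: "blinfun_apply (differential A (trace_fun r (Suc k)) p) v
      = lin_trace (\<lambda>w. (?T ^^ k) (R' v w))" for k v
  proof -
    have "((\<lambda>x. (1 / real (Suc k)) * lin_trace (R x ^^ Suc k)) has_derivative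
        (\<lambda>u. (1 / real (Suc k)) * (real (Suc k) * lin_trace (\<lambda>w. (?T ^^ k) (R' u w))))) (at x0)"
      using has_derivative_lin_trace_power[OF F open_chart_image[OF c] x0 lin deriv lin', of k]
      unfolding T by (rule has_derivative_mult_right)
    then have "((\<lambda>x. (1 / real (Suc k)) * lin_trace (R x ^^ Suc k)) has_derivative
        (\<lambda>u. lin_trace (\<lambda>w. (?T ^^ k) (R' u w)))) (at x0)"
      by simp
    then have D: "((trace_fun r (Suc k) \<circ> chart_inv c) has_derivative
        (\<lambda>u. lin_trace (\<lambda>w. (?T ^^ k) (R' u w)))) (at x0)"
      by (rule has_derivative_transform_within_open[OF _ open_chart_image[OF c] x0])
        (simp add: trace_fun_in_chart[OF c] R_def)
    show ?thesis
      unfolding differential_def c_def[symmetric] x0_def[symmetric]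
        frechet_derivative_at[OF D, symmetric]
      by (simp add: bounded_linear_Blinfun_apply has_derivative_bounded_linear[OF D])
  qed
  show "differential A (trace_fun r (Suc (Suc k))) p
      = dual_endo r (differential A (trace_fun r (Suc k))) p"
  proof (rule blinfun_eqI)
    fix v
    have "lin_trace (\<lambda>w. (?T ^^ k) (R' (?T v) w)) = lin_trace (\<lambda>w. (?T ^^ Suc k) (R' v w))"
    proof (rule torsion_free_trace[OF F])
      show "linear ?T"
        by (simp add: bounded_linear.linear blinfun.bounded_linear_right)
      show "linear (\<lambda>u. R' u v)" for v
        using deriv has_derivative_linear by blast
      show "R' (?T v) w - R' (?T w) v = ?T (R' v w - R' w v)" for w
        unfolding R'_def R_def c_def x0_def by (rule nijenhuis_in_coordinates[OF r])
    qed
    then show "blinfun_apply (differential A (trace_fun r (Suc (Suc k))) p) v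
        = blinfun_apply (dual_endo r (differential A (trace_fun r (Suc k))) p) v"
      by (simp only: d dual_endo_def blinfun_apply_blinfun_compose comp_apply)
  qed
qed

end

text \<open>By the Lenard relation the orbit of \<open>(X, d\<phi>\<^sub>1)\<close> under \<open>(r, r\<^sup>*)\<close> consists of the pairs
  \<open>(r\<^sup>kX, d\<phi>\<^sub>k\<^sub>+\<^sub>1)\<close>, and compatibility keeps it in \<open>L\<close>.\<close>

lemma hamiltonian_vf_trace_fun:
  assumes M: "smooth_manifold A" and DN: "dirac_nijenhuis A L r"
    and X: "hamiltonian_vf A L (trace_fun r 1) X"
  shows "hamiltonian_vf A L (trace_fun r (Suc k)) ((app_endo r ^^ k) X)"
proof (induction k)
  case 0
  show ?case using X by simp
next
  case (Suc k)
  interpret smooth_manifold A by (rule M)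
  let ?Y = "(app_endo r ^^ k) X" and ?\<alpha> = "differential A (trace_fun r (Suc k))"
  have r: "smooth_endo A r" "nijenhuis A r" "compatible A L r"
    using DN by (auto simp: dirac_nijenhuis_def)
  have Y: "smooth_vf A ?Y" "smooth_form A ?\<alpha>" "\<And>p. (?Y p, ?\<alpha> p) \<in> L p"
    using Suc by (auto simp: hamiltonian_vf_def sections_def smooth_gen_def comp_def)
  have "smooth_vf A (app_endo r ?Y)" "smooth_form A (dual_endo r ?\<alpha>)"
    using Y r by (simp_all add: smooth_vf_app_endo smooth_form_dual_endo)
  moreover have "(app_endo r ?Y p, dual_endo r ?\<alpha> p) \<in> L p" for p
    using Y(3)[of p] r(3) unfolding compatible_def app_endo_def dual_endo_def by fast
  ultimately show ?case
    using r
    by (simp add: hamiltonian_vf_def sections_def smooth_gen_def comp_def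
        differential_trace_fun_Suc)
qed

text \<open>The iterated Lenard relation, which turns every value in the proof below into one of \<open>d\<phi>\<^sub>1\<close>.\<close>

lemma differential_app_endo_power:
  assumes M: "smooth_manifold A" and r: "smooth_endo A r" "nijenhuis A r"
  shows "blinfun_apply (differential A (trace_fun r (Suc k)) p) v
    = blinfun_apply (differential A (trace_fun r 1) p) ((blinfun_apply (r p) ^^ k) v)"
proof (induction k arbitrary: v)
  case (Suc k)
  then show ?case
    by (simp add: smooth_manifold.differential_trace_fun_Suc[OF M r] dual_endo_def funpow_swap1)
qed simp

theorem proposition4p6:
  fixes A :: "('a::{t2_space, second_countable_topology}, 'e::real_inner) chart set"
    and L :: "'a \<Rightarrow> 'e gen_vector set"
    and r :: "('a, 'e) endo_field"
  assumes "smooth_manifold A"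
    and "dirac_nijenhuis A L r"
    and "admissible A L (trace_fun r 1)"
  shows "(\<forall>i\<ge>2. admissible A L (trace_fun r i)) \<and>
         (\<forall>i\<ge>1. \<forall>j\<ge>1. \<forall>p. poisson_bracket A L (trace_fun r i) (trace_fun r j) p = 0)"
proof -
  let ?d = "\<lambda>k p. blinfun_apply (differential A (trace_fun r k) p)"
  have r: "smooth_endo A r" "nijenhuis A r"
    using assms(2) by (auto simp: dirac_nijenhuis_def)
  note d = differential_app_endo_power[OF assms(1) r]
  obtain X where X: "hamiltonian_vf A L (trace_fun r 1) X"
    using assms(3) by (auto simp: admissible_def)
  note ham = hamiltonian_vf_trace_fun[OF assms(1,2) X]
  have isotropic: "?d i p (Y p) + ?d j p (Z p) = 0"
    if "hamiltonian_vf A L (trace_fun r j) Y" "hamiltonian_vf A L (trace_fun r i) Z" for i j Y Z p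
  proof -
    have Y: "(Y p, differential A (trace_fun r j) p) \<in> L p"
      and Z: "(Z p, differential A (trace_fun r i) p) \<in> L p"
      using that by (simp_all add: hamiltonian_vf_def sections_def)
    have "\<forall>p. L p = orth_compl (L p)"
      using assms(2) unfolding dirac_nijenhuis_def dirac_structure_def by (elim conjE)
    then have "L p = orth_compl (L p)" ..
    then have "(Z p, differential A (trace_fun r i) p) \<in> orth_compl (L p)"
      by (rule equalityD1[THEN subsetD, OF _ Z])
    then have "\<forall>b\<in>L p. pairing (Z p, differential A (trace_fun r i) p) b = 0"
      by (simp only: orth_compl_def mem_Collect_eq)
    from bspec[OF this Y] show ?thesis
      by (simp add: pairing_def add.commute)
  qed
  have power: "(app_endo r ^^ k) X p = (blinfun_apply (r p) ^^ k) (X p)" for k p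
    by (induction k) (simp_all add: app_endo_def)
  \<comment> \<open>The pairing of \<open>(X, d\<phi>\<^sub>1)\<close> with \<open>(r\<^sup>kX, (r\<^sup>*)\<^sup>k d\<phi>\<^sub>1)\<close> is twice this value.\<close>
  have zero: "?d 1 p ((blinfun_apply (r p) ^^ k) (X p)) = 0" for k p
    using isotropic[OF ham[of k] X, of p] by (simp add: power d[of k])
  \<comment> \<open>The bracket is defined by an arbitrary Hamiltonian field \<open>Y\<close> of \<open>\<phi>\<^sub>m\<^sub>+\<^sub>1\<close>. Isotropy moves the evaluation
    from \<open>Y\<close> to the Hamiltonian field \<open>r\<^sup>nX\<close> of \<open>\<phi>\<^sub>n\<^sub>+\<^sub>1\<close>.\<close>
  have bracket: "poisson_bracket A L (trace_fun r (Suc m)) (trace_fun r (Suc n)) p = 0" for m n p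
  proof -
    define Y where "Y = (SOME Y. hamiltonian_vf A L (trace_fun r (Suc m)) Y)"
    have "hamiltonian_vf A L (trace_fun r (Suc m)) Y"
      unfolding Y_def using ham[of m] by (rule someI[of "hamiltonian_vf A L (trace_fun r (Suc m))"])
    from isotropic[OF ham[of n] this, of p]
    have "?d (Suc n) p (Y p) = - ?d (Suc m) p ((blinfun_apply (r p) ^^ n) (X p))"
      by (simp add: power)
    also have "\<dots> = - ?d 1 p ((blinfun_apply (r p) ^^ (m + n)) (X p))"
      by (simp add: d[of m] funpow_add)
    finally show ?thesis
      using zero by (simp add: poisson_bracket_def Y_def Let_def)
  qed
  have "admissible A L (trace_fun r i)" if "i \<ge> 2" for i
    using ham[of "i - 1"] smooth_manifold.smooth_fun_trace_fun[OF assms(1) r(1)] that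
    by (auto simp: admissible_def)
  moreover have "poisson_bracket A L (trace_fun r i) (trace_fun r j) p = 0" if "i \<ge> 1" "j \<ge> 1"
    for i j p
    using bracket[of "i - 1" "j - 1" p] that by simp
  ultimately show ?thesis by blast
qed

end
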